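(* Let $d=1$, $\beta>0$, $M>0$, and let $W\in C(\mathbb T^1)$, $W\geq 0$, $\int_{\mathbb T^1}W\,\mathrm dx=1$, satisfy $W=W^\#$. Then the variational problem $\inf_{\varrho\in\mathcal A_M}\mathcal F_\beta(\varrho)$ admits a global minimizer $\varrho\in\mathcal A_M$ which is, up to a translation, even and nonincreasing (on $[0,1/2]$), i.e. for some $x_0\in\mathbb T^1$, $$\varrho(x)=\varrho^\#(x-x_0)\quad\text{for a.e. }x\in\mathbb T^1 .$$ If $W=W^\#$ is, in addition, strictly decreasing on $[0,1/2]$, then for every global minimizer $\varrho$ of this problem there is $x_0\in\mathbb T^1$ such that $\varrho(x)=\varrho^\#(x-x_0)$ for a.e. $x\in\mathbb T^1$.
   Context: $\mathbb T^1=\mathbb R/\mathbb Z$ is identified with $(-1/2,1/2]$. For a nonnegative measurable $h$ on $\mathbb T^1$, $h^\#$ denotes its symmetric decreasing rearrangement centered at the origin: the function that is even, nonincreasing on $[0,1/2]$ and equimeasurable with $h$. $W\ast\varrho$ is the periodic convolution. The free energy is $$\mathcal F_\beta(\varrho)=\int_{\mathbb T^1}\varrho(\log\varrho-1)\,\mathrm dx-\beta\int_{\mathbb T^1}\varrho\,(W\ast\varrho)\,\mathrm dx ,$$ with $0\log0=0$, and $$\mathcal A_M=\left\{\varrho\in L^1(\mathbb T^1):\ \varrho\ge0,\ \int_{\mathbb T^1}\varrho\,\mathrm dx=M,\ \int_{\mathbb T^1}\varrho\log\varrho\,\mathrm dx<+\infty\right\}.$$ *)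

theory Defs
  imports "HOL-Analysis.Analysis"
begin

text \<open>
  A function on the torus of real numbers modulo 1 is a 1-periodic function on the reals;
  \<^term>\<open>periodic_fun_simple' f\<close> says that \<^term>\<open>f\<close> has period 1. Integrals and almost-everywhere
  statements over the torus refer to Lebesgue measure on the fundamental domain (-1/2, 1/2].
  Only Borel representatives are considered; every element of L1 of the torus has one.
\<close>

definition torus :: "real measure" where
  "torus = restrict_space lborel {-1/2<..1/2}"

text \<open>The representative of a real number modulo 1 in (-1/2, 1/2].\<close>

definition torus_rep :: "real \<Rightarrow> real" where
  "torus_rep x = x - of_int \<lceil>x - 1/2\<rceil>"

text \<open>
  The symmetric decreasing rearrangement, by the layer-cake formula: \<^term>\<open>sdr_set A\<close> is the open
  arc centred at 0 with the measure of \<^term>\<open>A\<close>, and the whole torus if \<^term>\<open>A\<close> has full measure.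
  The second clause only adds the point 1/2. It makes \<^term>\<open>sdr h = h\<close> hold at every point when
  \<^term>\<open>h\<close> is continuous, even and nonincreasing on [0, 1/2]. The values are in \<^typ>\<open>ennreal\<close> because
  the rearrangement of an essentially unbounded function is infinite at 0.
\<close>

definition sdr_set :: "real set \<Rightarrow> real set" where
  "sdr_set A = {x. 2 * \<bar>torus_rep x\<bar> < measure torus A \<or> measure torus A = 1}"

definition sdr :: "(real \<Rightarrow> real) \<Rightarrow> real \<Rightarrow> ennreal" where
  "sdr h x = (SUP t\<in>{t. 0 \<le> t \<and> x \<in> sdr_set {y \<in> space torus. t < h y}}. ennreal t)"

definition torus_conv :: "(real \<Rightarrow> real) \<Rightarrow> (real \<Rightarrow> real) \<Rightarrow> real \<Rightarrow> real" where
  "torus_conv f g x = (\<integral>y. f (x - y) * g y \<partial>torus)"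

text \<open>Since \<^term>\<open>ln (0::real) = 0\<close>, the convention 0 log 0 = 0 is respected.\<close>

definition free_energy :: "real \<Rightarrow> (real \<Rightarrow> real) \<Rightarrow> (real \<Rightarrow> real) \<Rightarrow> real" where
  "free_energy \<beta> W \<rho> =
     (\<integral>x. \<rho> x * (ln (\<rho> x) - 1) \<partial>torus) - \<beta> * (\<integral>x. \<rho> x * torus_conv W \<rho> x \<partial>torus)"

text \<open>
  As \<open>r * ln r\<close> is bounded below for \<open>r \<ge> 0\<close> and the torus has finite measure, the entropy integral
  is well defined in the extended reals and is less than infinity iff the integrand is integrable.
\<close>

definition admissible :: "real \<Rightarrow> (real \<Rightarrow> real) set" where
  "admissible M = {\<rho>. periodic_fun_simple' \<rho> \<and> integrable torus \<rho> \<and> (AE x in torus. 0 \<le> \<rho> x) \<and>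
     (\<integral>x. \<rho> x \<partial>torus) = M \<and> integrable torus (\<lambda>x. \<rho> x * ln (\<rho> x))}"

definition global_minimizer :: "real \<Rightarrow> real \<Rightarrow> (real \<Rightarrow> real) \<Rightarrow> (real \<Rightarrow> real) \<Rightarrow> bool" where
  "global_minimizer \<beta> M W \<rho> \<longleftrightarrow> is_arg_min (free_energy \<beta> W) (\<lambda>\<sigma>. \<sigma> \<in> admissible M) \<rho>"

text \<open>
  The lemmas below show that \<^term>\<open>sdr h\<close> is 1-periodic, even, nonincreasing on [0, 1/2] and
  equimeasurable with \<^term>\<open>h\<close>, that these properties determine it almost everywhere, and that it
  fixes the continuous functions which are even and nonincreasing on [0, 1/2].
\<close>

lemma space_torus [simp]: "space torus = {-1/2<..1/2}"
  by (simp add: torus_def space_restrict_space)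

lemma sets_torus: "A \<in> sets torus \<longleftrightarrow> A \<subseteq> {-1/2<..1/2} \<and> A \<in> sets borel"
  by (subst torus_def, subst sets_restrict_space_iff) auto

lemma measure_torus: "A \<subseteq> {-1/2<..1/2} \<Longrightarrow> measure torus A = measure lborel A"
  by (simp add: torus_def measure_restrict_space)

lemma prob_torus: "emeasure torus (space torus) = 1"
  by (simp add: torus_def emeasure_restrict_space space_restrict_space)

lemma finite_measure_torus: "finite_measure torus"
  by (rule finite_measureI) (simp add: prob_torus del: space_torus)

interpretation torus: finite_measure torus
  by (rule finite_measure_torus)

lemma measure_torus_le_1: "measure torus A \<le> 1"
  using torus.bounded_measure[of A] prob_torus by (simp add: measure_def del: space_torus)

lemma torus_rep_in: "torus_rep x \<in> {-1/2<..1/2}"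
  unfolding torus_rep_def by simp linarith

lemma torus_rep_eq: "x \<in> {-1/2<..1/2} \<Longrightarrow> torus_rep x = x"
  unfolding torus_rep_def by (simp add: ceiling_eq_iff)

lemma abs_torus_rep_minus: "\<bar>torus_rep (- x)\<bar> = \<bar>torus_rep x\<bar>"
proof (cases "torus_rep x = 1/2")
  case True
  define k where "k = \<lceil>x - 1/2\<rceil>"
  have x: "x = 1/2 + of_int k"
    using True by (simp add: torus_rep_def k_def)
  have "\<lceil>- x - 1/2\<rceil> = - k - 1"
    by (rule ceiling_unique) (simp_all add: x)
  hence "torus_rep (- x) = 1/2"
    by (simp add: torus_rep_def x)
  thus ?thesis using True by simp
next
  case False
  define k where "k = \<lceil>x - 1/2\<rceil>"
  have k: "torus_rep x = x - of_int k"
    by (simp add: torus_rep_def k_def)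
  have "\<lceil>- x - 1/2\<rceil> = - k"
    using torus_rep_in[of x] False unfolding k by (intro ceiling_unique) auto
  hence "torus_rep (- x) = - torus_rep x"
    by (simp add: torus_rep_def flip: k_def)
  thus ?thesis by simp
qed

lemma sdr_periodic: "periodic_fun_simple' (sdr h)"
proof
  fix x :: real
  have "\<lceil>x + 1 - 1/2\<rceil> = \<lceil>x - 1/2\<rceil> + 1"
    by (metis (no_types, lifting) add_diff_eq add.commute ceiling_add_one diff_add_eq)
  hence "torus_rep (x + 1) = torus_rep x"
    by (simp add: torus_rep_def)
  thus "sdr h (x + 1) = sdr h x"
    by (simp add: sdr_def sdr_set_def)
qed

lemma sdr_even: "sdr h (- x) = sdr h x"
  by (simp add: sdr_def sdr_set_def abs_torus_rep_minus)

lemma sdr_antimono: "antimono_on {0..1/2} (sdr h)"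
proof (rule monotone_onI)
  fix x y :: real
  assume "x \<in> {0..1/2}" "y \<in> {0..1/2}" "x \<le> y"
  thus "sdr h y \<le> sdr h x"
    unfolding sdr_def sdr_set_def
    by (intro SUP_subset_mono) (auto simp: torus_rep_eq)
qed

lemma less_sdr_iff:
  assumes "0 \<le> t" "x \<in> space torus"
  shows "ennreal t < sdr h x \<longleftrightarrow>
    (\<exists>s>t. 2 * \<bar>x\<bar> < measure torus {y \<in> space torus. s < h y} \<or>
           measure torus {y \<in> space torus. s < h y} = 1)"
    (is "_ \<longleftrightarrow> (\<exists>s>t. ?P s)")
proof -
  have "ennreal t < sdr h x \<longleftrightarrow> (\<exists>s. 0 \<le> s \<and> ?P s \<and> ennreal t < ennreal s)"
    using assms(2) torus_rep_eq[of x]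
    by (simp add: sdr_def sdr_set_def less_SUP_iff conj_assoc)
  also have "\<dots> \<longleftrightarrow> (\<exists>s>t. ?P s)"
  proof -
    have "ennreal t < ennreal s \<longleftrightarrow> t < s" for s
      by (rule ennreal_less_iff[OF assms(1)])
    moreover have "0 \<le> s" if "t < s" for s
      using that assms(1) by linarith
    ultimately show ?thesis by blast
  qed
  finally show ?thesis .
qed

lemma less_sdr_between:
  assumes h: "h \<in> borel_measurable torus" and t: "0 \<le> t" and x: "x \<in> space torus"
  shows "2 * \<bar>x\<bar> < measure torus {y \<in> space torus. t < h y} \<Longrightarrow> ennreal t < sdr h x"
    and "ennreal t < sdr h x \<Longrightarrow> 2 * \<bar>x\<bar> \<le> measure torus {y \<in> space torus. t < h y}"
proof -
  define m where "m s = measure torus {y \<in> space torus. s < h y}" for s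
  have meas: "{y \<in> space torus. s < h y} \<in> sets torus" for s
    using h by measurable
  have mono: "m s' \<le> m s" if "s \<le> s'" for s s'
    unfolding m_def using that by (intro torus.finite_measure_mono meas) auto
  show "ennreal t < sdr h x" if less: "2 * \<bar>x\<bar> < measure torus {y \<in> space torus. t < h y}"
  proof -
    have "(\<lambda>n. m (t + 1 / Suc n)) \<longlonglongrightarrow>
            measure torus (\<Union>n. {y \<in> space torus. t + 1 / Suc n < h y})"
      unfolding m_def
    proof (intro torus.finite_Lim_measure_incseq)
      show "incseq (\<lambda>n. {y \<in> space torus. t + 1 / Suc n < h y})"
      proof (rule monoI, rule subsetI)
        fix n k :: nat and y
        assume "n \<le> k" "y \<in> {y \<in> space torus. t + 1 / Suc n < h y}"
        moreover from \<open>n \<le> k\<close> have "1 / real (Suc k) \<le> 1 / real (Suc n)"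
          by (intro divide_left_mono) auto
        ultimately show "y \<in> {y \<in> space torus. t + 1 / Suc k < h y}" by auto
      qed
    qed (use meas in auto)
    also have "(\<Union>n. {y \<in> space torus. t + 1 / Suc n < h y}) = {y \<in> space torus. t < h y}"
    proof (intro equalityI subsetI)
      fix y assume y: "y \<in> {y \<in> space torus. t < h y}"
      then obtain n where "inverse (real (Suc n)) < h y - t"
        using reals_Archimedean[of "h y - t"] by auto
      with y show "y \<in> (\<Union>n. {y \<in> space torus. t + 1 / Suc n < h y})"
        by (auto simp: inverse_eq_divide intro!: exI[of _ n])
    next
      fix y assume "y \<in> (\<Union>n. {y \<in> space torus. t + 1 / Suc n < h y})"
      then obtain n where "y \<in> space torus" "t + 1 / Suc n < h y" by blast
      moreover have "0 < 1 / real (Suc n)" by simp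
      ultimately have "t < h y" by linarith
      with \<open>y \<in> space torus\<close> show "y \<in> {y \<in> space torus. t < h y}"
        by blast
    qed
    finally have "eventually (\<lambda>n. 2 * \<bar>x\<bar> < m (t + 1 / Suc n)) sequentially"
      using less by (rule order_tendstoD(1))
    then obtain n where "2 * \<bar>x\<bar> < m (t + 1 / Suc n)"
      by (auto simp: eventually_sequentially)
    moreover have "t < t + 1 / Suc n" by simp
    ultimately show ?thesis
      using t x unfolding less_sdr_iff[OF t x] m_def by blast
  qed
  show "2 * \<bar>x\<bar> \<le> measure torus {y \<in> space torus. t < h y}" if less: "ennreal t < sdr h x"
  proof -
    obtain s where "s > t" "2 * \<bar>x\<bar> < m s \<or> m s = 1"
      using less unfolding less_sdr_iff[OF t x] m_def by blast
    with mono[of t s] x show ?thesis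
      unfolding m_def by auto
  qed
qed

lemma measure_torus_arc:
  assumes "0 \<le> r" "r \<le> 1/2"
  shows "measure torus {x \<in> space torus. \<bar>x\<bar> < r} = 2 * r"
    and "measure torus {x \<in> space torus. \<bar>x\<bar> \<le> r} = 2 * r"
proof -
  have 1: "{x \<in> space torus. \<bar>x\<bar> < r} = {-r<..<r}"
    using assms by auto
  show "measure torus {x \<in> space torus. \<bar>x\<bar> < r} = 2 * r"
    unfolding 1 using assms by (subst measure_torus) auto
  show "measure torus {x \<in> space torus. \<bar>x\<bar> \<le> r} = 2 * r"
  proof (cases "r = 1/2")
    case True
    hence 2: "{x \<in> space torus. \<bar>x\<bar> \<le> r} = {-r<..r}"
      by auto
    show ?thesis unfolding 2 using True by (subst measure_torus) auto
  next
    case False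
    hence 2: "{x \<in> space torus. \<bar>x\<bar> \<le> r} = {-r..r}"
      using assms by auto
    show ?thesis unfolding 2 using assms False by (subst measure_torus) auto
  qed
qed

lemma measure_between_arcs:
  assumes "0 \<le> m" "m \<le> 1"
    and 1: "{x \<in> space torus. 2 * \<bar>x\<bar> < m} \<subseteq> S"
    and 2: "S \<subseteq> {x \<in> space torus. 2 * \<bar>x\<bar> \<le> m}"
  shows "S \<in> sets torus" "measure torus S = m"
proof -
  have arcs: "{x \<in> space torus. 2 * \<bar>x\<bar> < m} \<in> sets torus" 
    "{x \<in> space torus. 2 * \<bar>x\<bar> \<le> m} \<in> sets torus"
    unfolding sets_torus by auto
  have fin: "finite (S - {x \<in> space torus. 2 * \<bar>x\<bar> < m})"
    by (rule finite_subset[of _ "{m/2, -m/2}"]) (use 2 in \<open>auto simp: abs_if split: if_splits\<close>)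
  have eq: "{x \<in> space torus. 2 * \<bar>x\<bar> < m} \<union> (S - {x \<in> space torus. 2 * \<bar>x\<bar> < m}) = S"
    using 1 by blast
  have "S - {x \<in> space torus. 2 * \<bar>x\<bar> < m} \<in> sets torus"
    unfolding sets_torus using 2 fin by (auto intro: finite_imp_closed borel_closed)
  from sets.Un[OF arcs(1) this] show S: "S \<in> sets torus"
    unfolding eq .
  have "measure torus {x \<in> space torus. 2 * \<bar>x\<bar> < m} = m"
  proof -
    have "{x \<in> space torus. 2 * \<bar>x\<bar> < m} = {x \<in> space torus. \<bar>x\<bar> < m / 2}"
      by (auto simp del: space_torus)
    thus ?thesis using measure_torus_arc(1)[of "m/2"] assms(1,2) by (simp del: space_torus)
  qed
  moreover have "measure torus {x \<in> space torus. 2 * \<bar>x\<bar> \<le> m} = m"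
  proof -
    have "{x \<in> space torus. 2 * \<bar>x\<bar> \<le> m} = {x \<in> space torus. \<bar>x\<bar> \<le> m / 2}"
      by (auto simp del: space_torus)
    thus ?thesis using measure_torus_arc(2)[of "m/2"] assms(1,2) by (simp del: space_torus)
  qed
  ultimately show "measure torus S = m"
    using torus.finite_measure_mono[OF 1 S] torus.finite_measure_mono[OF 2 arcs(2)] by linarith
qed

lemma sdr_equimeasurable:
  assumes h: "h \<in> borel_measurable torus" and t: "0 \<le> t"
  shows "{x \<in> space torus. ennreal t < sdr h x} \<in> sets torus"
    and "measure torus {x \<in> space torus. ennreal t < sdr h x} =
         measure torus {x \<in> space torus. t < h x}"
proof -
  have "{x \<in> space torus. 2 * \<bar>x\<bar> < measure torus {x \<in> space torus. t < h x}}
          \<subseteq> {x \<in> space torus. ennreal t < sdr h x}"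
    using less_sdr_between(1)[OF h t] by blast
  moreover have "{x \<in> space torus. ennreal t < sdr h x}
          \<subseteq> {x \<in> space torus. 2 * \<bar>x\<bar> \<le> measure torus {x \<in> space torus. t < h x}}"
    using less_sdr_between(2)[OF h t] by blast
  ultimately have *:
    "{x \<in> space torus. ennreal t < sdr h x} \<in> sets torus \<and>
     measure torus {x \<in> space torus. ennreal t < sdr h x} = measure torus {x \<in> space torus. t < h x}"
    using measure_between_arcs[OF measure_nonneg measure_torus_le_1] by blast
  show "{x \<in> space torus. ennreal t < sdr h x} \<in> sets torus"
    using * ..
  show "measure torus {x \<in> space torus. ennreal t < sdr h x} =
        measure torus {x \<in> space torus. t < h x}"
    using * ..
qed

lemma sdr_unique:
  fixes g :: "real \<Rightarrow> ennreal"
  assumes h: "h \<in> borel_measurable torus" and g: "g \<in> borel_measurable torus"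
    and even: "\<And>x. g (- x) = g x" and anti: "antimono_on {0..1/2} g"
    and equi: "\<And>t. 0 \<le> t \<Longrightarrow> measure torus {x \<in> space torus. ennreal t < g x} =
                            measure torus {x \<in> space torus. t < h x}"
  shows "AE x in torus. g x = sdr h x"
proof -
  define m where "m t = measure torus {y \<in> space torus. t < h y}" for t
  have g_mono: "g x \<le> g y" if "x \<in> space torus" "y \<in> space torus" "\<bar>y\<bar> \<le> \<bar>x\<bar>" for x y
  proof -
    have abs: "g z = g \<bar>z\<bar>" for z using even by (simp add: abs_if)
    show ?thesis unfolding abs[of x] abs[of y]
      by (rule monotone_onD[OF anti]) (use that in auto)
  qed
  have 1: "ennreal t < g x" if "0 \<le> t" "x \<in> space torus" "2 * \<bar>x\<bar> < m t" for t x
  proof (rule ccontr)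
    assume "\<not> ?thesis"
    hence "{y \<in> space torus. ennreal t < g y} \<subseteq> {y \<in> space torus. \<bar>y\<bar> < \<bar>x\<bar>}"
      using g_mono[of _ x] g_mono[of x] that(2) by (fastforce simp: not_less)
    hence "m t \<le> measure torus {y \<in> space torus. \<bar>y\<bar> < \<bar>x\<bar>}"
      unfolding m_def equi[OF that(1), symmetric]
      by (rule torus.finite_measure_mono) (auto simp: sets_torus)
    moreover have "measure torus {y \<in> space torus. \<bar>y\<bar> < \<bar>x\<bar>} = 2 * \<bar>x\<bar>"
      by (rule measure_torus_arc(1)) (use that(2) in auto)
    ultimately show False using that(3) by linarith
  qed
  have 2: "2 * \<bar>x\<bar> \<le> m t" if "0 \<le> t" "x \<in> space torus" "ennreal t < g x" for t x
  proof -
    have "{y \<in> space torus. \<bar>y\<bar> \<le> \<bar>x\<bar>} \<subseteq> {y \<in> space torus. ennreal t < g y}"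
      using g_mono[of x] that by (fastforce intro: less_le_trans)
    hence "measure torus {y \<in> space torus. \<bar>y\<bar> \<le> \<bar>x\<bar>} \<le> m t"
      unfolding m_def equi[OF that(1), symmetric]
      by (rule torus.finite_measure_mono) (use g in measurable)
    moreover have "measure torus {y \<in> space torus. \<bar>y\<bar> \<le> \<bar>x\<bar>} = 2 * \<bar>x\<bar>"
      by (rule measure_torus_arc(2)) (use that(2) in auto)
    ultimately show ?thesis by linarith
  qed
  define N where "N = (\<Union>q::rat. {m (of_rat q) / 2, - m (of_rat q) / 2})"
  have "countable N" unfolding N_def by auto
  hence "AE x in lborel. x \<notin> N"
    by (intro AE_not_in) (rule countable_imp_null_set_lborel)
  hence "AE x in torus. x \<notin> N"
    unfolding torus_def by (subst AE_restrict_space_iff) auto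
  thus ?thesis
  proof (rule AE_mp, intro AE_I2 impI)
    fix x assume x: "x \<in> space torus" and "x \<notin> N"
    have ne: "2 * \<bar>x\<bar> \<noteq> m (of_rat q)" for q
    proof
      assume "2 * \<bar>x\<bar> = m (of_rat q)"
      hence "x = m (of_rat q) / 2 \<or> x = - m (of_rat q) / 2"
        by (auto simp: abs_if split: if_splits)
      with \<open>x \<notin> N\<close> show False
        unfolding N_def by blast
    qed
    have iff: "ennreal (of_rat q) < g x \<longleftrightarrow> ennreal (of_rat q) < sdr h x" if "0 \<le> q" for q
    proof -
      have q: "0 \<le> real_of_rat q" using that by simp
      show ?thesis
        using 1[OF q x] 2[OF q x] less_sdr_between[OF h q x] ne[of q] unfolding m_def by fastforce
    qed
    have between: "\<exists>r\<ge>0. a < ennreal r \<and> ennreal r < b" if ab: "a < b" for a b :: ennreal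
    proof -
      obtain c where c: "a < c" "c < b"
        using dense[OF ab] by blast
      have "c < top"
        by (rule less_le_trans[OF c(2)]) simp
      hence "ennreal (enn2real c) = c" by simp
      with c show ?thesis
        by (intro exI[of _ "enn2real c"]) simp
    qed
    have dense: "\<exists>q\<ge>0. a \<le> ennreal (of_rat q) \<and> ennreal (of_rat q) < b" if ab: "a < b" for a b :: ennreal
    proof -
      obtain r where r: "a < ennreal r" "ennreal r < b" "0 \<le> r"
        using between[OF ab] by blast
      obtain r' where r': "ennreal r < ennreal r'" "ennreal r' < b" "0 \<le> r'"
        using between[OF r(2)] by blast
      have "r < r'" using r' r by (simp add: ennreal_less_iff)
      then obtain q where q: "r < of_rat q" "of_rat q < r'" using of_rat_dense by blast
      hence "0 \<le> real_of_rat q" using r by linarith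
      hence "0 \<le> q" by simp
      moreover have "a \<le> ennreal (of_rat q)"
        using r(1) q(1) by (meson ennreal_leI less_imp_le order_trans)
      moreover have "ennreal (of_rat q) < b"
        using r'(2) q(2) by (meson ennreal_leI less_imp_le le_less_trans)
      ultimately show ?thesis by blast
    qed
    have "\<not> g x < sdr h x"
      using dense[of "g x" "sdr h x"] iff by (auto simp: not_less[symmetric])
    moreover have "\<not> sdr h x < g x"
      using dense[of "sdr h x" "g x"] iff by (auto simp: not_less[symmetric])
    ultimately show "g x = sdr h x" by auto
  qed
qed

lemma sdr_fixes_continuous:
  assumes per: "periodic_fun_simple' W" and cont: "continuous_on UNIV W" and nonneg: "\<And>x. 0 \<le> W x"
    and even: "\<And>x. W (- x) = W x" and anti: "antimono_on {0..1/2} W"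
  shows "sdr W x = ennreal (W x)"
proof -
  interpret W: periodic_fun_simple' W by fact
  define y where "y = \<bar>torus_rep x\<bar>"
  have y: "0 \<le> y" "y \<le> 1/2" using torus_rep_in[of x] by (auto simp: y_def)
  have abs: "W z = W \<bar>z\<bar>" for z using even by (simp add: abs_if)
  have Wx: "W x = W y"
    using abs[of "torus_rep x"] by (simp add: y_def torus_rep_def W.minus_of_int)
  have Wm: "W v \<le> W u" if "0 \<le> u" "u \<le> v" "v \<le> 1/2" for u v
    by (rule monotone_onD[OF anti]) (use that in auto)
  have W: "W \<in> borel_measurable borel"
    using cont by (rule borel_measurable_continuous_onI)
  have sets: "{z \<in> space torus. t < W z} \<in> sets torus" for t
    using W by (auto simp: torus_def space_restrict_space sets_restrict_space_iff)
  define m where "m t = measure torus {z \<in> space torus. t < W z}" for t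
  have sdr: "sdr W x = (SUP t\<in>{t. 0 \<le> t \<and> (2 * y < m t \<or> m t = 1)}. ennreal t)"
    by (simp add: sdr_def sdr_set_def y_def m_def)
  show ?thesis
  proof (rule antisym)
    show "sdr W x \<le> ennreal (W x)"
      unfolding sdr
    proof (rule SUP_least, rule ennreal_leI, rule ccontr)
      fix t assume t: "t \<in> {t. 0 \<le> t \<and> (2 * y < m t \<or> m t = 1)}" and "\<not> t \<le> W x"
      hence Wt: "W y < t" by (simp add: Wx)
      have "\<exists>d>0. \<forall>z. \<bar>z - y\<bar> < d \<longrightarrow> W z < t"
      proof -
        have "isCont W y" using cont by (simp add: continuous_on_eq_continuous_at)
        hence "eventually (\<lambda>z. W z < t) (nhds y)"
          using Wt unfolding isCont_def by (metis order_tendstoD(2) tendsto_at_iff_tendsto_nhds)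
        thus ?thesis
          by (auto simp: eventually_nhds_metric dist_real_def)
      qed
      then obtain d where d: "d > 0" "\<And>z. \<bar>z - y\<bar> < d \<Longrightarrow> W z < t" by blast
      define r where "r = max 0 (y - d / 2)"
      have r: "0 \<le> r" "r \<le> y" "r \<le> 1/2" "y > 0 \<Longrightarrow> r < y" "y - d < r" using d(1) y by (auto simp: r_def max_def min_def)
      have "{z \<in> space torus. t < W z} \<subseteq> {z \<in> space torus. \<bar>z\<bar> < r}"
      proof safe
        fix z assume z: "z \<in> space torus" "t < W z"
        show "\<bar>z\<bar> < r"
        proof (rule ccontr)
          assume "\<not> \<bar>z\<bar> < r"
          hence "W \<bar>z\<bar> \<le> W r" using Wm[of r "\<bar>z\<bar>"] z r by auto
          moreover have "W r < t" using d(2)[of r] r d(1) by auto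
          ultimately show False using z abs[of z] by simp
        qed
      qed
      hence "m t \<le> measure torus {z \<in> space torus. \<bar>z\<bar> < r}"
        unfolding m_def by (rule torus.finite_measure_mono) (auto simp: sets_torus)
      also have "\<dots> = 2 * r" using measure_torus_arc(1)[of r] r by simp
      finally have "m t \<le> 2 * r" .
      with t r y show False by (cases "y > 0") auto
    qed
    show "ennreal (W x) \<le> sdr W x"
    proof (rule ccontr)
      assume "\<not> ?thesis"
      hence less: "sdr W x < ennreal (W x)" by simp
      then obtain c where c: "sdr W x < c" "c < ennreal (W x)" using dense by blast
      define t where "t = enn2real c"
      have "c < top" using c(2) by (metis ennreal_less_top less_trans)
      hence t: "0 \<le> t" "sdr W x < ennreal t" "t < W y"
        using c nonneg by (auto simp: t_def Wx enn2real_less_iff ennreal_enn2real_if)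
      have "\<exists>d>0. \<forall>z. \<bar>z - y\<bar> < d \<longrightarrow> t < W z"
      proof -
        have "isCont W y" using cont by (simp add: continuous_on_eq_continuous_at)
        hence "eventually (\<lambda>z. t < W z) (nhds y)"
          using t(3) unfolding isCont_def by (metis order_tendstoD(1) tendsto_at_iff_tendsto_nhds)
        thus ?thesis
          by (auto simp: eventually_nhds_metric dist_real_def)
      qed
      then obtain d where d: "d > 0" "\<And>z. \<bar>z - y\<bar> < d \<Longrightarrow> t < W z" by blast
      define r where "r = min (1/2) (y + d / 2)"
      have r: "0 \<le> r" "y \<le> r" "r \<le> 1/2" "r < y + d" "y < r \<or> r = 1/2"
        using d(1) y by (auto simp: r_def max_def min_def)
      have "{z \<in> space torus. \<bar>z\<bar> \<le> r} \<subseteq> {z \<in> space torus. t < W z}"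
      proof safe
        fix z assume z: "z \<in> space torus" "\<bar>z\<bar> \<le> r"
        have "W r \<le> W \<bar>z\<bar>" using Wm[of "\<bar>z\<bar>" r] z r by auto
        moreover have "t < W r" using d(2)[of r] r d(1) by auto
        ultimately show "t < W z" using abs[of z] by simp
      qed
      hence "measure torus {z \<in> space torus. \<bar>z\<bar> \<le> r} \<le> m t"
        unfolding m_def by (rule torus.finite_measure_mono) (rule sets)
      moreover have "measure torus {z \<in> space torus. \<bar>z\<bar> \<le> r} = 2 * r"
        using measure_torus_arc(2)[of r] r by simp
      moreover have "m t \<le> 1" unfolding m_def by (rule measure_torus_le_1)
      ultimately have "2 * y < m t \<or> m t = 1" using r(5) by auto
      hence "ennreal t \<le> sdr W x"
        unfolding sdr using t(1) by (intro SUP_upper) auto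
      with t(2) show False by simp
    qed
  qed
qed

end

theory Submission
  imports Defs "HOL-Complex_Analysis.Great_Picard"
begin

text \<open>
  The proof avoids the Riesz rearrangement inequality. Replacing a density by the Gibbs density of its
  own potential lowers the energy of a convex combination to first order by their relative entropy.
  Hence a minimizer coincides with its Gibbs density, and along a minimizing sequence the Gibbs
  densities, whose potentials are precompact by Arzela-Ascoli, form a minimizing sequence too; their
  limit is a minimizer. In particular minimizers have continuous representatives.

  If W is strictly decreasing on [0, 1/2], symmetrizing a continuous minimizer g with respect to a pair of
  antipodal points a and a + 1/2 preserves the entropy and strictly increases the interaction, unless
  g (a + t) - g (a - t) has constant sign for t in [0, 1/2]. A continuous function with this property
  for every a is a translate of an even function nonincreasing on [0, 1/2]: by connectedness of the
  circle some a gives equality for all t. The property passes to pointwise limits, which gives a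
  minimizer of this form for general W as a limit of minimizers for W + cos (2 pi x) / n.
\<close>

section \<open>Integration over the torus\<close>

text \<open>A minimizing sequence is bounded only in L log L, whereas its convolutions with the
  continuous kernel are uniformly bounded and equicontinuous. Passing to Gibbs densities moves the
  limit to functions for which dominated convergence suffices. This needs a quantitative link
  between the excess energy and the distance to the Gibbs density. The kernel need not be of
  positive type, so along a segment with parameter t the first-order gain, t times the relative
  entropy, competes with an error of order t^2. Hence the relative entropy is at most excess / t + C
  t; small t makes it vanish in the limit, a Pinsker-type estimate turns this into L1 closeness, and
  the full step t = 1 then costs nothing in the limit. Continuity also matters for the symmetry:
  strictness of the interaction gain is read off at two single points, and connectedness of the
  circle is applied to closed sets of axes. The strict gain can be lost where W has flat parts,
  which is why a general W is reached by approximation.\<close>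

lemma periodic_cong_int:
  assumes "periodic_fun_simple' f" and "x - y = of_int k"
  shows "f x = f y"
proof -
  interpret periodic_fun_simple' f by fact
  show ?thesis
    using plus_of_int[of y k] assms(2) by (metis diff_add_cancel add.commute)
qed

lemma periodic_torus_rep: "periodic_fun_simple' f \<Longrightarrow> f (torus_rep x) = f x"
  by (rule periodic_cong_int[of f _ _ "- \<lceil>x - 1/2\<rceil>"]) (simp_all add: torus_rep_def)

lemma periodic_continuous_bounded:
  fixes f :: "real \<Rightarrow> real"
  assumes "periodic_fun_simple' f" "continuous_on UNIV f"
  obtains B where "0 \<le> B" "\<And>x. \<bar>f x\<bar> \<le> B"
proof -
  have "compact (f ` {-1/2..1/2})"
    by (intro compact_continuous_image continuous_on_subset[OF assms(2)]) auto
  then obtain B where B: "\<And>x. x \<in> {-1/2..1/2} \<Longrightarrow> norm (f x) \<le> B"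
    by (meson compact_imp_bounded bounded_iff imageI)
  have "\<bar>f x\<bar> \<le> B" for x
    using B[of "torus_rep x"] torus_rep_in[of x] periodic_torus_rep[OF assms(1), of x] by auto
  moreover from this[of 0] have "0 \<le> B" by linarith
  ultimately show ?thesis using that by blast
qed

lemma periodic_continuous_uniform:
  fixes f :: "real \<Rightarrow> real"
  assumes per: "periodic_fun_simple' f" and cont: "continuous_on UNIV f" and "0 < e"
  obtains d where "0 < d" "\<And>x y. \<bar>x - y\<bar> < d \<Longrightarrow> \<bar>f x - f y\<bar> < e"
proof -
  have "uniformly_continuous_on {-2..2} f"
    by (intro compact_uniformly_continuous continuous_on_subset[OF cont]) auto
  then obtain d where d: "0 < d"
    "\<And>x y. x \<in> {-2..2} \<Longrightarrow> y \<in> {-2..2} \<Longrightarrow> \<bar>x - y\<bar> < d \<Longrightarrow> \<bar>f x - f y\<bar> < e"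
    using \<open>0 < e\<close> unfolding uniformly_continuous_on_def dist_real_def by metis
  \<comment> \<open>For |x - y| < 1 the integer shift that brings x into (-1/2, 1/2] leaves the
    shifted y inside [-2, 2], where uniform continuity is available.\<close>
  have "\<bar>f x - f y\<bar> < e" if "\<bar>x - y\<bar> < min d 1" for x y
  proof -
    define k where "k = \<lceil>x - 1/2\<rceil>"
    have "f (x - of_int k) = f x" "f (y - of_int k) = f y"
      by (rule periodic_cong_int[OF per, of _ _ "-k"], simp)+
    moreover have "x - of_int k \<in> {-1/2<..1/2}"
      using torus_rep_in[of x] by (simp add: torus_rep_def k_def)
    moreover from this have "y - of_int k \<in> {-2..2}"
      using that by (auto simp: abs_less_iff)
    ultimately show ?thesis
      using d(2)[of "x - of_int k" "y - of_int k"] that by auto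
  qed
  thus ?thesis using that[of "min d 1"] d(1) by simp
qed

lemma measurable_torus:
  "f \<in> borel_measurable borel \<Longrightarrow> f \<in> borel_measurable torus"
  unfolding torus_def by (rule measurable_restrict_space1) simp

lemma continuous_measurable_torus:
  fixes f :: "real \<Rightarrow> real"
  shows "continuous_on UNIV f \<Longrightarrow> f \<in> borel_measurable torus"
  by (intro measurable_torus borel_measurable_continuous_onI)

text \<open>Bridge to the gauge integral over a closed interval, where splitting, reflection and
  translation of the interval can be used.\<close>

lemma torus_integral_continuous:
  fixes f :: "real \<Rightarrow> real"
  assumes "continuous_on UNIV f"
  shows "integrable torus f" and "(\<integral>x. f x \<partial>torus) = integral {-1/2..1/2} f"
proof -
  have "integrable lborel (\<lambda>x. indicator {-1/2..1/2} x *\<^sub>R f x)"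
    using borel_integrable_compact[of "{-1/2..1/2}" f] continuous_on_subset[OF assms]
    by (auto simp: set_integrable_def)
  hence 1: "set_integrable lborel {-1/2..1/2} f"
    by (simp add: set_integrable_def)
  hence 2: "set_integrable lborel {-1/2<..1/2} f"
    by (rule set_integrable_subset) auto
  thus "integrable torus f"
    unfolding torus_def by (simp add: integrable_restrict_space set_integrable_def)
  have "(\<integral>x. f x \<partial>torus) = (LINT x:{-1/2<..1/2}|lborel. f x)"
    unfolding torus_def by (simp add: integral_restrict_space set_lebesgue_integral_def)
  also have "\<dots> = integral {-1/2<..1/2} f"
    by (rule set_borel_integral_eq_integral(2)[OF 2])
  also have "\<dots> = integral {-1/2..1/2} f"
    by (rule integral_subset_negligible) (auto intro: negligible_subset[of "{-1/2}"])
  finally show "(\<integral>x. f x \<partial>torus) = integral {-1/2..1/2} f" .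
qed

text \<open>Pairing t with -t turns every comparison of integrals under a two-point exchange into a
  pointwise one on the half circle.\<close>

lemma torus_integral_fold:
  fixes f :: "real \<Rightarrow> real"
  assumes cont: "continuous_on UNIV f"
  shows "(\<integral>x. f x \<partial>torus) = integral {0..1/2} (\<lambda>t. f t + f (- t))"
proof -
  have int: "f integrable_on {a..b}" "(\<lambda>t. f (- t)) integrable_on {a..b}" for a b
    by (intro integrable_continuous_real continuous_on_subset[OF cont]
        continuous_on_compose2[OF cont] continuous_intros; simp)+
  have "(\<integral>x. f x \<partial>torus) = integral {-1/2..0} f + integral {0..1/2} f"
    using torus_integral_continuous(2)[OF cont] Henstock_Kurzweil_Integration.integral_combine[of "-1/2" 0 "1/2" f] int by simp
  also have "integral {-1/2..0} f = integral {0..1/2} (\<lambda>t. f (- t))"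
    using Henstock_Kurzweil_Integration.integral_reflect_real[of "1/2" 0 "\<lambda>t. f (- t)"] by simp
  finally show ?thesis
    using int by (simp add: Henstock_Kurzweil_Integration.integral_add)
qed

lemma torus_integral_reflect:
  fixes f :: "real \<Rightarrow> real"
  assumes cont: "continuous_on UNIV f"
  shows "(\<integral>x. f (- x) \<partial>torus) = (\<integral>x. f x \<partial>torus)"
proof -
  have "continuous_on UNIV (\<lambda>x. f (- x))"
    by (intro continuous_on_compose2[OF cont] continuous_intros) simp
  thus ?thesis
    by (simp add: torus_integral_fold cont add.commute)
qed

text \<open>Modulo 1 the shift is s in [0, 1); the part of the moved interval beyond 1/2 is carried
  back by one period to fill the gap at the left end.\<close>

lemma torus_integral_shift:
  fixes f :: "real \<Rightarrow> real"
  assumes per: "periodic_fun_simple' f" and cont: "continuous_on UNIV f"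
  shows "(\<integral>x. f (x + a) \<partial>torus) = (\<integral>x. f x \<partial>torus)"
proof -
  have int: "f integrable_on {b..c}" for b c
    by (intro integrable_continuous_real continuous_on_subset[OF cont]) simp
  have sh: "integral {b..c} (\<lambda>x. f (x + s)) = integral {b+s..c+s} f" for b c s
    using integral_shift_Icc_real[of b c f s] by (simp add: o_def add.commute)
  define s where "s = frac a"
  have s: "0 \<le> s" "s < 1" by (simp_all add: s_def frac_lt_1)
  have "f (x + a) = f (x + s)" for x
    by (rule periodic_cong_int[OF per, of _ _ "\<lfloor>a\<rfloor>"]) (simp add: s_def frac_def)
  hence "(\<integral>x. f (x + a) \<partial>torus) = (\<integral>x. f (x + s) \<partial>torus)" by simp
  also have "\<dots> = integral {-1/2..1/2} (\<lambda>x. f (x + s))"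
    by (intro torus_integral_continuous(2) continuous_on_compose2[OF cont] continuous_intros) simp
  also have "\<dots> = integral {-1/2+s..1/2+s} f"
    by (rule sh)
  also have "\<dots> = integral {-1/2+s..1/2} f + integral {1/2..1/2+s} f"
    using s int by (intro Henstock_Kurzweil_Integration.integral_combine[symmetric]) auto
  also have "integral {1/2..1/2+s} f = integral {-1/2..-1/2+s} (\<lambda>x. f (x + 1))"
    by (simp add: sh)
  also have "\<dots> = integral {-1/2..-1/2+s} f"
    using per by (simp add: periodic_fun_simple'.plus_period)
  also have "integral {-1/2+s..1/2} f + integral {-1/2..-1/2+s} f = integral {-1/2..1/2} f"
    using Henstock_Kurzweil_Integration.integral_combine[of "-1/2" "-1/2+s" "1/2" f] s int by simp
  also have "\<dots> = (\<integral>x. f x \<partial>torus)"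
    by (rule torus_integral_continuous(2)[OF cont, symmetric])
  finally show ?thesis .
qed

lemma torus_integrable_mult_bounded:
  fixes f g :: "real \<Rightarrow> real"
  assumes f: "integrable torus f" and g: "g \<in> borel_measurable torus" and B: "\<And>x. \<bar>g x\<bar> \<le> B"
  shows "integrable torus (\<lambda>x. f x * g x)" and "integrable torus (\<lambda>x. g x * f x)"
proof -
  show "integrable torus (\<lambda>x. g x * f x)"
  proof (rule Bochner_Integration.integrable_bound)
    show "integrable torus (\<lambda>x. B * f x)" using f by simp
    show "AE x in torus. norm (g x * f x) \<le> norm (B * f x)"
    proof (rule AE_I2)
      fix x show "norm (g x * f x) \<le> norm (B * f x)"
        using B[of x] by (auto simp: abs_mult intro!: mult_right_mono)
    qed
  qed (use f g in measurable)
  thus "integrable torus (\<lambda>x. f x * g x)" by (simp add: mult.commute)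
qed

lemma torus_integral_abs_mult_bound:
  fixes f g :: "real \<Rightarrow> real"
  assumes f: "integrable torus f" and g: "g \<in> borel_measurable torus" and B: "\<And>x. \<bar>g x\<bar> \<le> B"
  shows "\<bar>\<integral>x. f x * g x \<partial>torus\<bar> \<le> B * (\<integral>x. \<bar>f x\<bar> \<partial>torus)"
proof -
  have "\<bar>\<integral>x. f x * g x \<partial>torus\<bar> \<le> (\<integral>x. B * \<bar>f x\<bar> \<partial>torus)"
  proof (rule integral_abs_bound_integral)
    fix x show "\<bar>f x * g x\<bar> \<le> B * \<bar>f x\<bar>"
      using mult_right_mono[OF B[of x], of "\<bar>f x\<bar>"] by (simp add: abs_mult mult.commute)
  qed (use torus_integrable_mult_bounded[OF assms] f in auto)
  thus ?thesis by simp
qed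

section \<open>Convolution with a continuous even kernel\<close>

text \<open>The bilinear form whose diagonal is the interaction energy; two arguments are kept for
  expansions along segments and for polarization.\<close>

definition interaction :: "(real \<Rightarrow> real) \<Rightarrow> (real \<Rightarrow> real) \<Rightarrow> (real \<Rightarrow> real) \<Rightarrow> real" where
  "interaction W f g = (\<integral>x. f x * torus_conv W g x \<partial>torus)"

lemma pair_sigma_finite_torus: "pair_sigma_finite torus torus"
  by (intro pair_sigma_finite.intro torus.sigma_finite_measure_axioms)

text \<open>The assumptions are those shared by W, the cosine, which changes sign, and their
  combinations, so that all of them are instances.\<close>

locale torus_kernel =
  fixes W :: "real \<Rightarrow> real"
  assumes per: "periodic_fun_simple' W" and cont: "continuous_on UNIV W" and even: "\<And>x. W (- x) = W x"
begin

definition bound :: real where "bound = (SUP x. \<bar>W x\<bar>)"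

lemma le_bound: "\<bar>W x\<bar> \<le> bound"
proof -
  obtain B where "\<And>x. \<bar>W x\<bar> \<le> B"
    using periodic_continuous_bounded[OF per cont] by blast
  thus ?thesis
    unfolding bound_def by (intro cSUP_upper bdd_aboveI2[of _ _ B]) auto
qed

lemma bound_nonneg: "0 \<le> bound"
  using le_bound[of 0] by linarith

lemma borel_measurable_kernel [measurable]: "W \<in> borel_measurable borel"
  by (rule borel_measurable_continuous_onI[OF cont])

lemma conv_measurable: "(\<lambda>y. W (x - y)) \<in> borel_measurable torus"
  by (rule measurable_torus) measurable

lemma conv_integrable: "integrable torus f \<Longrightarrow> integrable torus (\<lambda>y. W (x - y) * f y)"
  by (rule torus_integrable_mult_bounded(2)[OF _ conv_measurable le_bound])

lemma conv_cong_AE: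
  assumes "f \<in> borel_measurable torus" "g \<in> borel_measurable torus" "AE x in torus. f x = g x"
  shows "torus_conv W f x = torus_conv W g x"
  unfolding torus_conv_def using assms conv_measurable[of x]
  by (intro integral_cong_AE) auto

lemma conv_bound:
  assumes "integrable torus f"
  shows "\<bar>torus_conv W f x\<bar> \<le> bound * (\<integral>y. \<bar>f y\<bar> \<partial>torus)"
  using torus_integral_abs_mult_bound[OF assms conv_measurable le_bound, of x]
  by (simp add: torus_conv_def mult.commute)

text \<open>The convolution inherits the uniform modulus of continuity of W. The order of
  quantifiers matters: d is chosen before f, as Arzela-Ascoli requires.\<close>

lemma conv_equicontinuous:
  assumes "0 < e"
  obtains d where "0 < d" "\<And>f x y. integrable torus f \<Longrightarrow> \<bar>x - y\<bar> < d \<Longrightarrow>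
    \<bar>torus_conv W f x - torus_conv W f y\<bar> \<le> e * (\<integral>z. \<bar>f z\<bar> \<partial>torus)"
proof -
  obtain d where d: "0 < d" "\<And>x y. \<bar>x - y\<bar> < d \<Longrightarrow> \<bar>W x - W y\<bar> < e"
    using periodic_continuous_uniform[OF per cont \<open>0 < e\<close>] by blast
  have "\<bar>torus_conv W f x - torus_conv W f y\<bar> \<le> e * (\<integral>z. \<bar>f z\<bar> \<partial>torus)"
    if f: "integrable torus f" and xy: "\<bar>x - y\<bar> < d" for f x y
  proof -
    have "torus_conv W f x - torus_conv W f y = (\<integral>z. f z * (W (x - z) - W (y - z)) \<partial>torus)"
      unfolding torus_conv_def using conv_integrable[OF f]
      by (subst Bochner_Integration.integral_diff[symmetric]) (auto simp: algebra_simps)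
    also have "\<bar>\<dots>\<bar> \<le> e * (\<integral>z. \<bar>f z\<bar> \<partial>torus)"
    proof (rule torus_integral_abs_mult_bound[OF f])
      show "\<bar>W (x - z) - W (y - z)\<bar> \<le> e" for z
        using d(2)[of "x - z" "y - z"] xy by simp
    qed (use conv_measurable[of x] conv_measurable[of y] in measurable)
    finally show ?thesis .
  qed
  thus ?thesis using that d(1) by blast
qed

lemma conv_continuous:
  assumes f: "integrable torus f"
  shows "continuous_on UNIV (torus_conv W f)"
proof (unfold continuous_on_iff dist_real_def, intro ballI allI impI)
  fix x e :: real assume "0 < e"
  define I where "I = (\<integral>z. \<bar>f z\<bar> \<partial>torus)"
  have I: "0 \<le> I" by (simp add: I_def)
  \<comment> \<open>I may vanish, hence I + 1 in the denominator.\<close>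
  hence "0 < e / (I + 1)" using \<open>0 < e\<close> by simp
  then obtain d where d: "0 < d" "\<And>y. \<bar>y - x\<bar> < d \<Longrightarrow>
      \<bar>torus_conv W f y - torus_conv W f x\<bar> \<le> e / (I + 1) * I"
    using conv_equicontinuous[of "e / (I + 1)"] f unfolding I_def by metis
  have "e / (I + 1) * I < e" using I \<open>0 < e\<close> by (simp add: field_simps)
  thus "\<exists>d>0. \<forall>x'\<in>UNIV. \<bar>x' - x\<bar> < d \<longrightarrow> \<bar>torus_conv W f x' - torus_conv W f x\<bar> < e"
    using d by (meson le_less_trans)
qed

lemma conv_periodic: "periodic_fun_simple' (torus_conv W f)"
proof
  fix x
  have "W (x + 1 - y) = W (x - y)" for y
    by (rule periodic_cong_int[OF per, of _ _ 1]) simp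
  thus "torus_conv W f (x + 1) = torus_conv W f x"
    by (simp add: torus_conv_def)
qed

lemma conv_borel [measurable]: "integrable torus f \<Longrightarrow> torus_conv W f \<in> borel_measurable torus"
  by (intro continuous_measurable_torus conv_continuous)

lemma interaction_integrable:
  "integrable torus f \<Longrightarrow> integrable torus g \<Longrightarrow> integrable torus (\<lambda>x. f x * torus_conv W g x)"
  by (rule torus_integrable_mult_bounded(1)[OF _ conv_borel conv_bound])

lemma interaction_bound:
  assumes "integrable torus f" "integrable torus g"
  shows "\<bar>interaction W f g\<bar> \<le> bound * (\<integral>x. \<bar>f x\<bar> \<partial>torus) * (\<integral>x. \<bar>g x\<bar> \<partial>torus)"
  using torus_integral_abs_mult_bound[OF assms(1) conv_borel conv_bound, OF assms(2) assms(2)]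
  by (simp add: interaction_def mult_ac)

lemma interaction_cong_AE:
  assumes [measurable]: "integrable torus f" "integrable torus g" "integrable torus f'" "integrable torus g'"
    and "AE x in torus. f x = f' x" "AE x in torus. g x = g' x"
  shows "interaction W f g = interaction W f' g'"
proof -
  have "torus_conv W g = torus_conv W g'"
    using assms by (intro ext conv_cong_AE) auto
  thus ?thesis
    unfolding interaction_def using assms(5) by (intro integral_cong_AE) auto
qed

text \<open>Sums and differences are obtained with the coefficients 1 and -1; later definitions
  spell these out to match this pattern.\<close>

lemma interaction_lincomb_left:
  assumes "integrable torus f" "integrable torus g" "integrable torus h"
  shows "interaction W (\<lambda>x. a * f x + b * g x) h = a * interaction W f h + b * interaction W g h"
proof -
  have "interaction W (\<lambda>x. a * f x + b * g x) h =
      (\<integral>x. a * (f x * torus_conv W h x) + b * (g x * torus_conv W h x) \<partial>torus)"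
    unfolding interaction_def by (simp add: algebra_simps)
  also have "\<dots> = a * interaction W f h + b * interaction W g h"
    unfolding interaction_def using interaction_integrable assms
    by (simp add: Bochner_Integration.integral_add)
  finally show ?thesis .
qed

text \<open>Fubini and evenness of W. Bounding |W| by \<open>bound\<close> dominates the inner
  integral by a multiple of |f|, which gives integrability on the product.\<close>

lemma interaction_commute:
  assumes f: "integrable torus f" and g: "integrable torus g"
  shows "interaction W f g = interaction W g f"
proof -
  interpret pair_sigma_finite torus torus by (rule pair_sigma_finite_torus)
  have [measurable]: "f \<in> borel_measurable torus" "g \<in> borel_measurable torus"
    using f g by auto
  have [measurable]: "(\<lambda>x. x) \<in> measurable torus borel"
    by (rule measurable_torus) simp
  have meas: "(\<lambda>(x, y). f x * (W (x - y) * g y)) \<in> borel_measurable (torus \<Otimes>\<^sub>M torus)"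
    by measurable
  have int: "integrable (torus \<Otimes>\<^sub>M torus) (\<lambda>(x, y). f x * (W (x - y) * g y))"
  proof (rule Fubini_integrable[OF meas])
    show "integrable torus (\<lambda>x. \<integral>y. norm (case (x, y) of (x, y) \<Rightarrow> f x * (W (x - y) * g y)) \<partial>torus)"
    proof (rule Bochner_Integration.integrable_bound)
      show "integrable torus (\<lambda>x. f x * (bound * (\<integral>y. \<bar>g y\<bar> \<partial>torus)))"
        using f by simp
      show "(\<lambda>x. \<integral>y. norm (case (x, y) of (x, y) \<Rightarrow> f x * (W (x - y) * g y)) \<partial>torus) \<in> borel_measurable torus"
        by measurable
      show "AE x in torus. norm (\<integral>y. norm (case (x, y) of (x, y) \<Rightarrow> f x * (W (x - y) * g y)) \<partial>torus)
              \<le> norm (f x * (bound * (\<integral>y. \<bar>g y\<bar> \<partial>torus)))"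
      proof (rule AE_I2)
        fix x
        have "(\<integral>y. norm (case (x, y) of (x, y) \<Rightarrow> f x * (W (x - y) * g y)) \<partial>torus)
            = \<bar>f x\<bar> * (\<integral>y. \<bar>g y\<bar> * \<bar>W (x - y)\<bar> \<partial>torus)"
          by (simp add: abs_mult mult_ac)
        also have "\<bar>\<dots>\<bar> \<le> \<bar>f x\<bar> * (bound * (\<integral>y. \<bar>\<bar>g y\<bar>\<bar> \<partial>torus))"
          using torus_integral_abs_mult_bound[of "\<lambda>y. \<bar>g y\<bar>" "\<lambda>y. \<bar>W (x - y)\<bar>" bound] g
            conv_measurable[of x] le_bound by (auto simp: abs_mult intro!: mult_left_mono)
        finally show "norm (\<integral>y. norm (case (x, y) of (x, y) \<Rightarrow> f x * (W (x - y) * g y)) \<partial>torus)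
              \<le> norm (f x * (bound * (\<integral>y. \<bar>g y\<bar> \<partial>torus)))"
          using bound_nonneg by (simp add: abs_mult)
      qed
    qed
    show "AE x in torus. integrable torus (\<lambda>y. case (x, y) of (x, y) \<Rightarrow> f x * (W (x - y) * g y))"
      using conv_integrable[OF g] by simp
  qed
  have "interaction W f g = (\<integral>x. \<integral>y. f x * (W (x - y) * g y) \<partial>torus \<partial>torus)"
    unfolding interaction_def torus_conv_def by simp
  also have "\<dots> = (\<integral>y. \<integral>x. f x * (W (x - y) * g y) \<partial>torus \<partial>torus)"
    using Fubini_integral[OF int] by simp
  also have "\<dots> = (\<integral>y. g y * (\<integral>x. W (y - x) * f x \<partial>torus) \<partial>torus)"
  proof (rule Bochner_Integration.integral_cong[OF refl])
    fix y
    have "W (x - y) = W (y - x)" for x using even[of "x - y"] by simp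
    hence "(\<integral>x. f x * (W (x - y) * g y) \<partial>torus) = (\<integral>x. g y * (W (y - x) * f x) \<partial>torus)"
      by (simp add: mult_ac)
    thus "(\<integral>x. f x * (W (x - y) * g y) \<partial>torus) = g y * (\<integral>x. W (y - x) * f x \<partial>torus)"
      by simp
  qed
  finally show ?thesis unfolding interaction_def torus_conv_def .
qed

lemma interaction_lincomb_right:
  assumes "integrable torus f" "integrable torus g" "integrable torus h"
  shows "interaction W h (\<lambda>x. a * f x + b * g x) = a * interaction W h f + b * interaction W h g"
  using interaction_lincomb_left[OF assms] assms by (simp add: interaction_commute)

end

section \<open>Entropy and Gibbs densities\<close>

text \<open>The Bregman divergence of r ln r. The linear terms make it nonnegative pointwise, and
  their integrals cancel for densities of equal mass. Since \<open>ln 0 = 0\<close>, its value at x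
  = 0 is y.\<close>

definition rel_ent :: "real \<Rightarrow> real \<Rightarrow> real" where
  "rel_ent x y = x * ln x - x * ln y - x + y"

text \<open>Hellinger lower bound, from ln z \<le> z - 1 at z = sqrt (y / x). Nonnegativity, the
  equality case and the L1 estimate all derive from it.\<close>

lemma sqrt_diff_le_rel_ent:
  assumes "0 \<le> x" "0 < y"
  shows "(sqrt x - sqrt y)\<^sup>2 \<le> rel_ent x y"
proof (cases "x = 0")
  case True
  thus ?thesis using assms by (simp add: rel_ent_def)
next
  case False
  hence x: "0 < x" using assms by simp
  have "2 * ln (sqrt (y / x)) = ln (y / x)"
    using x assms by (simp add: ln_sqrt)
  hence "ln y - ln x = 2 * ln (sqrt (y / x))"
    using x assms by (simp add: ln_div)
  also have "\<dots> \<le> 2 * (sqrt (y / x) - 1)"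
    using ln_le_minus_one[of "sqrt (y / x)"] x assms by simp
  finally have "x * (ln y - ln x) \<le> x * (2 * (sqrt (y / x) - 1))"
    using x by (intro mult_left_mono) auto
  also have "x * sqrt (y / x) = sqrt x * sqrt y"
    using x by (simp add: real_sqrt_divide field_simps)
  hence "x * (2 * (sqrt (y / x) - 1)) = 2 * (sqrt x * sqrt y) - 2 * x"
    by (simp add: algebra_simps)
  finally show ?thesis
    using x assms by (simp add: rel_ent_def power2_diff algebra_simps)
qed

lemma rel_ent_nonneg: "0 \<le> x \<Longrightarrow> 0 < y \<Longrightarrow> 0 \<le> rel_ent x y"
  using sqrt_diff_le_rel_ent[of x y] by (meson order_trans zero_le_power2)

lemma rel_ent_eq_0: "0 \<le> x \<Longrightarrow> 0 < y \<Longrightarrow> rel_ent x y = 0 \<Longrightarrow> x = y"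
  using sqrt_diff_le_rel_ent[of x y] by simp

text \<open>Pointwise substitute for Pinsker's inequality: factor x - y through square roots and
  apply Young's inequality with weight \<delta> to |a - b| (a + b). The free \<delta> takes the
  place of the square root of the entropy.\<close>

lemma diff_le_rel_ent:
  assumes "0 \<le> x" "0 < y" "0 < \<delta>"
  shows "\<bar>x - y\<bar> \<le> rel_ent x y / \<delta> + \<delta> * (x + y)"
proof -
  define a b where "a = sqrt x" and "b = sqrt y"
  have ab: "x = a\<^sup>2" "y = b\<^sup>2" "0 \<le> a" "0 \<le> b" using assms by (auto simp: a_def b_def)
  have "(p - \<delta> / 2 * q)\<^sup>2 = p\<^sup>2 - \<delta> * (p * q) + \<delta>\<^sup>2 * (q\<^sup>2 / 4)" for p q
    by (simp add: power2_eq_square algebra_simps)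
  from this[of "\<bar>a - b\<bar>" "a + b"] zero_le_power2[of "\<bar>a - b\<bar> - \<delta> / 2 * (a + b)"]
  have "\<delta> * (\<bar>a - b\<bar> * (a + b)) \<le> (a - b)\<^sup>2 + \<delta>\<^sup>2 * ((a + b)\<^sup>2 / 4)"
    by simp
  also have "(a + b)\<^sup>2 / 4 \<le> a\<^sup>2 + b\<^sup>2"
  proof -
    have "p / 4 \<le> r + s" if "p = r + s + c" "c \<le> r + s" "0 \<le> r" "0 \<le> s" for p r s c :: real
      using that by linarith
    from this[OF power2_sum sum_squares_bound] show ?thesis by simp
  qed
  hence "(a - b)\<^sup>2 + \<delta>\<^sup>2 * ((a + b)\<^sup>2 / 4) \<le> rel_ent x y + \<delta>\<^sup>2 * (x + y)"
    using sqrt_diff_le_rel_ent[OF assms(1,2)] unfolding ab(1,2)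
    by (intro add_mono mult_left_mono) (simp_all add: ab(3,4))
  finally have "\<delta> * \<bar>x - y\<bar> \<le> rel_ent x y + \<delta>\<^sup>2 * (x + y)"
    using ab by (simp add: power2_eq_square abs_mult square_diff_square_factored mult_ac)
  thus ?thesis using assms(3) by (simp add: field_simps power2_eq_square)
qed

text \<open>The convexity gap is the weighted average of the divergences of a and b from their mean
  m: the terms with ln m and the linear terms collapse because m is the mean. No derivative at 0 is
  involved.\<close>

lemma mult_ln_convex:
  fixes a b t :: real
  assumes "0 \<le> a" "0 \<le> b" "0 \<le> t" "t \<le> 1"
  shows "((1 - t) * a + t * b) * ln ((1 - t) * a + t * b) \<le> (1 - t) * (a * ln a) + t * (b * ln b)"
proof (cases "(1 - t) * a + t * b = 0")
  case True
  hence "(1 - t) * a = 0" "t * b = 0"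
    using assms by (smt (verit) mult_nonneg_nonneg)+
  thus ?thesis using True by auto
next
  case False
  define m where "m = (1 - t) * a + t * b"
  have m: "0 < m" using False assms unfolding m_def
    by (smt (verit) mult_nonneg_nonneg)
  have "0 \<le> (1 - t) * rel_ent a m + t * rel_ent b m"
    using assms m rel_ent_nonneg by (intro add_nonneg_nonneg mult_nonneg_nonneg) auto
  also have "\<dots> = (1 - t) * (a * ln a) + t * (b * ln b) - m * ln m"
    by (simp add: rel_ent_def m_def algebra_simps)
  finally show ?thesis by (simp add: m_def)
qed

lemma mult_ln_ge: "0 \<le> x \<Longrightarrow> x - 1 \<le> x * ln (x :: real)"
  using rel_ent_nonneg[of x 1] by (simp add: rel_ent_def)

definition entropy :: "(real \<Rightarrow> real) \<Rightarrow> real" where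
  "entropy \<rho> = (\<integral>x. \<rho> x * (ln (\<rho> x) - 1) \<partial>torus)"

lemma free_energy_eq: "free_energy \<beta> W \<rho> = entropy \<rho> - \<beta> * interaction W \<rho> \<rho>"
  by (simp add: free_energy_def entropy_def interaction_def)

lemma admissibleD:
  assumes "\<rho> \<in> admissible M"
  shows "periodic_fun_simple' \<rho>" "integrable torus \<rho>" "AE x in torus. 0 \<le> \<rho> x" "(\<integral>x. \<rho> x \<partial>torus) = M"
    "integrable torus (\<lambda>x. \<rho> x * ln (\<rho> x))" "(\<integral>x. \<bar>\<rho> x\<bar> \<partial>torus) = M"
proof -
  show *: "periodic_fun_simple' \<rho>" "integrable torus \<rho>" "AE x in torus. 0 \<le> \<rho> x" "(\<integral>x. \<rho> x \<partial>torus) = M"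
    "integrable torus (\<lambda>x. \<rho> x * ln (\<rho> x))"
    using assms by (auto simp: admissible_def)
  have "(\<integral>x. \<bar>\<rho> x\<bar> \<partial>torus) = (\<integral>x. \<rho> x \<partial>torus)"
    using * by (intro integral_cong_AE) auto
  thus "(\<integral>x. \<bar>\<rho> x\<bar> \<partial>torus) = M" using * by simp
qed

lemma entropy_eq:
  assumes "\<rho> \<in> admissible M"
  shows "entropy \<rho> = (\<integral>x. \<rho> x * ln (\<rho> x) \<partial>torus) - M"
proof -
  have "entropy \<rho> = (\<integral>x. \<rho> x * ln (\<rho> x) - \<rho> x \<partial>torus)"
    by (simp add: entropy_def algebra_simps)
  thus ?thesis using admissibleD[OF assms] by (simp add: Bochner_Integration.integral_diff)
qed

lemma entropy_ge:
  assumes "\<rho> \<in> admissible M"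
  shows "-1 \<le> entropy \<rho>"
proof -
  note * = admissibleD[OF assms]
  have "(\<integral>x. \<rho> x - 1 \<partial>torus) \<le> (\<integral>x. \<rho> x * ln (\<rho> x) \<partial>torus)"
    using * by (intro integral_mono_AE) (auto simp: mult_ln_ge)
  moreover have "(\<integral>x. \<rho> x - 1 \<partial>torus) = M - 1"
    using * by (subst Bochner_Integration.integral_diff) (auto simp: measure_torus)
  ultimately show ?thesis using entropy_eq[OF assms] by simp
qed

lemma
  assumes \<rho>: "\<rho> \<in> admissible M" and \<sigma>: "\<sigma> \<in> admissible M" and t: "0 \<le> t" "t \<le> 1"
  shows admissible_mix: "(\<lambda>x. (1 - t) * \<rho> x + t * \<sigma> x) \<in> admissible M"
    and entropy_mix: "entropy (\<lambda>x. (1 - t) * \<rho> x + t * \<sigma> x) \<le> (1 - t) * entropy \<rho> + t * entropy \<sigma>"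
proof -
  note r = admissibleD[OF \<rho>] and s = admissibleD[OF \<sigma>]
  define \<tau> where "\<tau> x = (1 - t) * \<rho> x + t * \<sigma> x" for x
  have nonneg: "AE x in torus. 0 \<le> \<tau> x"
    using r(3) s(3) by eventually_elim (use t in \<open>auto simp: \<tau>_def\<close>)
  have int: "integrable torus \<tau>"
    unfolding \<tau>_def using r(2) s(2) by simp
  have convex: "AE x in torus. \<tau> x * ln (\<tau> x) \<le> (1 - t) * (\<rho> x * ln (\<rho> x)) + t * (\<sigma> x * ln (\<sigma> x))"
    using r(3) s(3) by eventually_elim (use t in \<open>simp add: \<tau>_def mult_ln_convex\<close>)
  have intln: "integrable torus (\<lambda>x. \<tau> x * ln (\<tau> x))"
  proof (rule Bochner_Integration.integrable_bound)
    \<comment> \<open>Convexity bounds \<tau> ln \<tau> from above by the first two summands; the 1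
      covers the lower bound -1 from \<open>mult_ln_ge\<close>.\<close>
    show "integrable torus (\<lambda>x. \<bar>\<rho> x * ln (\<rho> x)\<bar> + \<bar>\<sigma> x * ln (\<sigma> x)\<bar> + 1)"
      using r s by (intro Bochner_Integration.integrable_add integrable_abs) auto
    show "AE x in torus. norm (\<tau> x * ln (\<tau> x)) \<le> norm (\<bar>\<rho> x * ln (\<rho> x)\<bar> + \<bar>\<sigma> x * ln (\<sigma> x)\<bar> + 1)"
      using nonneg convex
    proof eventually_elim
      fix x assume x: "0 \<le> \<tau> x" "\<tau> x * ln (\<tau> x) \<le> (1 - t) * (\<rho> x * ln (\<rho> x)) + t * (\<sigma> x * ln (\<sigma> x))"
      have "c * y \<le> \<bar>y\<bar>" if "0 \<le> c" "c \<le> 1" for c y :: real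
        using that mult_right_mono[of c 1 "\<bar>y\<bar>"] mult_left_mono[of y "\<bar>y\<bar>" c] by linarith
      from this[of "1 - t" "\<rho> x * ln (\<rho> x)"] this[of t "\<sigma> x * ln (\<sigma> x)"]
      show "norm (\<tau> x * ln (\<tau> x)) \<le> norm (\<bar>\<rho> x * ln (\<rho> x)\<bar> + \<bar>\<sigma> x * ln (\<sigma> x)\<bar> + 1)"
        using x t mult_ln_ge[OF x(1)] by simp
    qed
  qed (use int in measurable)
  have per: "periodic_fun_simple' \<tau>"
  proof
    fix x show "\<tau> (x + 1) = \<tau> x"
      by (simp add: \<tau>_def periodic_fun_simple'.plus_period[OF r(1)] periodic_fun_simple'.plus_period[OF s(1)])
  qed
  have "(\<integral>x. \<tau> x \<partial>torus) = M"
    unfolding \<tau>_def using r s by (simp add: Bochner_Integration.integral_add algebra_simps)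
  with nonneg int intln per have adm: "\<tau> \<in> admissible M"
    by (simp add: admissible_def)
  thus "(\<lambda>x. (1 - t) * \<rho> x + t * \<sigma> x) \<in> admissible M"
    unfolding \<tau>_def .
  have "(\<integral>x. \<tau> x * ln (\<tau> x) \<partial>torus) \<le> (\<integral>x. (1 - t) * (\<rho> x * ln (\<rho> x)) + t * (\<sigma> x * ln (\<sigma> x)) \<partial>torus)"
    using convex intln r(5) s(5) by (intro integral_mono_AE) auto
  also have "\<dots> = (1 - t) * (\<integral>x. \<rho> x * ln (\<rho> x) \<partial>torus) + t * (\<integral>x. \<sigma> x * ln (\<sigma> x) \<partial>torus)"
    using r(5) s(5) by (simp add: Bochner_Integration.integral_add)
  finally have "entropy \<tau> \<le> (1 - t) * entropy \<rho> + t * entropy \<sigma>"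
    by (simp add: entropy_eq[OF adm] entropy_eq[OF \<rho>] entropy_eq[OF \<sigma>] algebra_simps)
  thus "entropy (\<lambda>x. (1 - t) * \<rho> x + t * \<sigma> x) \<le> (1 - t) * entropy \<rho> + t * entropy \<sigma>"
    unfolding \<tau>_def .
qed

lemma admissible_continuous:
  assumes "periodic_fun_simple' f" "continuous_on UNIV f" "\<And>x. 0 < f x" "(\<integral>x. f x \<partial>torus) = M"
  shows "f \<in> admissible M"
proof -
  have "continuous_on UNIV (\<lambda>x. f x * ln (f x))"
    using assms(2) assms(3) by (intro continuous_intros) (auto simp: less_imp_neq[THEN not_sym])
  hence "integrable torus (\<lambda>x. f x * ln (f x))"
    by (rule torus_integral_continuous)
  moreover have "AE x in torus. 0 \<le> f x"
    using assms(3) by (intro AE_I2) (simp add: less_imp_le)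
  ultimately show ?thesis
    using assms torus_integral_continuous(1)[of f] by (simp add: admissible_def)
qed

text \<open>Among admissible densities of mass M, this one minimizes the entropy minus the integral
  of \<rho> u; \<open>rel_ent_gibbs\<close> computes the gap. A large u attracts mass.\<close>

definition gibbs :: "real \<Rightarrow> (real \<Rightarrow> real) \<Rightarrow> real \<Rightarrow> real" where
  "gibbs M u x = M / (\<integral>y. exp (u y) \<partial>torus) * exp (u x)"

lemma
  fixes u :: "real \<Rightarrow> real"
  assumes "continuous_on UNIV u"
  shows integrable_exp_torus: "integrable torus (\<lambda>x. exp (u x))"
    and integral_exp_torus_pos: "0 < (\<integral>x. exp (u x) \<partial>torus)"
proof -
  show int: "integrable torus (\<lambda>x. exp (u x))"
    by (rule torus_integral_continuous(1)) (intro continuous_intros assms)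
  have "(\<integral>x. exp (u x) \<partial>torus) \<noteq> 0"
  proof
    assume "(\<integral>x. exp (u x) \<partial>torus) = 0"
    hence "AE x in torus. exp (u x) = 0"
      by (subst (asm) integral_nonneg_eq_0_iff_AE[OF int]) auto
    hence "AE x in torus. False" by simp
    thus False using prob_torus by (auto simp: AE_iff_null simp del: space_torus)
  qed
  moreover have "0 \<le> (\<integral>x. exp (u x) \<partial>torus)" by simp
  ultimately show "0 < (\<integral>x. exp (u x) \<partial>torus)" by linarith
qed

lemma
  assumes "periodic_fun_simple' u" "continuous_on UNIV u" "0 < M"
  shows gibbs_pos: "0 < gibbs M u x"
    and gibbs_continuous: "continuous_on UNIV (gibbs M u)"
    and gibbs_periodic: "periodic_fun_simple' (gibbs M u)"
    and gibbs_admissible: "gibbs M u \<in> admissible M"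
    and ln_gibbs: "ln (gibbs M u x) = u x + ln (M / (\<integral>y. exp (u y) \<partial>torus))"
proof -
  note Z = integral_exp_torus_pos[OF assms(2)]
  show pos: "0 < gibbs M u x" for x
    unfolding gibbs_def using Z \<open>0 < M\<close> by simp
  show c: "continuous_on UNIV (gibbs M u)"
    unfolding gibbs_def by (intro continuous_intros assms)
  show p: "periodic_fun_simple' (gibbs M u)"
    using assms(1) by unfold_locales (simp add: gibbs_def periodic_fun_simple'.plus_period)
  have "(\<integral>x. gibbs M u x \<partial>torus) = M"
    unfolding gibbs_def using Z by simp
  thus "gibbs M u \<in> admissible M"
    using c p pos by (intro admissible_continuous)
  show "ln (gibbs M u x) = u x + ln (M / (\<integral>y. exp (u y) \<partial>torus))"
    unfolding gibbs_def using Z \<open>0 < M\<close> by (subst ln_mult) auto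
qed

text \<open>Gibbs variational identity. The logarithm of the Gibbs density is u plus a constant, and
  the constant drops out because both densities have mass M.\<close>

lemma
  assumes u: "periodic_fun_simple' u" "continuous_on UNIV u" and M: "0 < M" and \<rho>: "\<rho> \<in> admissible M"
  shows rel_ent_gibbs_integrable: "integrable torus (\<lambda>x. rel_ent (\<rho> x) (gibbs M u x))"
    and rel_ent_gibbs: "(\<integral>x. rel_ent (\<rho> x) (gibbs M u x) \<partial>torus) =
      entropy \<rho> - entropy (gibbs M u) - (\<integral>x. (\<rho> x - gibbs M u x) * u x \<partial>torus)"
proof -
  define \<sigma> where "\<sigma> = gibbs M u"
  define c where "c = ln (M / (\<integral>y. exp (u y) \<partial>torus))"
  have adm: "\<sigma> \<in> admissible M" unfolding \<sigma>_def by (rule gibbs_admissible[OF u M])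
  note r = admissibleD[OF \<rho>] and s = admissibleD[OF adm]
  have ln\<sigma>: "ln (\<sigma> x) = u x + c" for x
    unfolding \<sigma>_def c_def by (rule ln_gibbs[OF u M])
  obtain B where B: "\<And>x. \<bar>u x\<bar> \<le> B"
    using periodic_continuous_bounded[OF u] by blast
  have int: "integrable torus (\<lambda>x. \<rho> x * u x)" "integrable torus (\<lambda>x. \<sigma> x * u x)"
    by (rule torus_integrable_mult_bounded[OF _ continuous_measurable_torus[OF u(2)] B]; fact)+
  have eq: "rel_ent (\<rho> x) (\<sigma> x) = \<rho> x * ln (\<rho> x) - \<rho> x * u x - (c + 1) * \<rho> x + \<sigma> x" for x
    by (simp add: rel_ent_def ln\<sigma> algebra_simps)
  show "integrable torus (\<lambda>x. rel_ent (\<rho> x) (gibbs M u x))"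
    unfolding \<sigma>_def[symmetric] eq using int r s by simp
  have "(\<integral>x. rel_ent (\<rho> x) (\<sigma> x) \<partial>torus) = (\<integral>x. \<rho> x * ln (\<rho> x) \<partial>torus) - (\<integral>x. \<rho> x * u x \<partial>torus) - (c + 1) * M + M"
    unfolding eq using int r s by (simp add: Bochner_Integration.integral_add Bochner_Integration.integral_diff)
  moreover have "entropy \<sigma> = (\<integral>x. \<sigma> x * u x \<partial>torus) + (c - 1) * M"
  proof -
    have "entropy \<sigma> = (\<integral>x. \<sigma> x * u x + (c - 1) * \<sigma> x \<partial>torus)"
      by (simp add: entropy_def ln\<sigma> algebra_simps)
    thus ?thesis using int s by (simp add: Bochner_Integration.integral_add)
  qed
  moreover have "(\<integral>x. (\<rho> x - \<sigma> x) * u x \<partial>torus) = (\<integral>x. \<rho> x * u x \<partial>torus) - (\<integral>x. \<sigma> x * u x \<partial>torus)"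
    using int by (simp add: left_diff_distrib Bochner_Integration.integral_diff)
  ultimately show "(\<integral>x. rel_ent (\<rho> x) (gibbs M u x) \<partial>torus) =
      entropy \<rho> - entropy (gibbs M u) - (\<integral>x. (\<rho> x - gibbs M u x) * u x \<partial>torus)"
    unfolding \<sigma>_def[symmetric] entropy_eq[OF \<rho>] by (simp add: algebra_simps)
qed

lemma torus_dominated_convergence:
  fixes f :: "real \<Rightarrow> real"
  assumes "f \<in> borel_measurable torus" "\<And>n. s n \<in> borel_measurable torus"
    and "\<And>x. (\<lambda>n. s n x) \<longlonglongrightarrow> f x" "\<And>n x. \<bar>s n x\<bar> \<le> B"
  shows "(\<lambda>n. \<integral>x. s n x \<partial>torus) \<longlonglongrightarrow> (\<integral>x. f x \<partial>torus)"
  by (rule integral_dominated_convergence[where w = "\<lambda>_. B"]) (use assms in auto)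

section \<open>Existence of minimizers and the Euler-Lagrange equation\<close>

locale free_energy_problem = torus_kernel +
  fixes \<beta> M :: real
  assumes \<beta>_pos: "0 < \<beta>" and M_pos: "0 < M"
begin

text \<open>The derivative at \<rho> of the quadratic interaction term, whence the factor 2.\<close>

abbreviation potential :: "(real \<Rightarrow> real) \<Rightarrow> real \<Rightarrow> real" where
  "potential \<rho> \<equiv> \<lambda>x. 2 * \<beta> * torus_conv W \<rho> x"

text \<open>Its fixed points are the solutions of the Euler-Lagrange equation;
  \<open>el_defect\<close> measures by how much \<rho> fails to be one.\<close>

abbreviation el_map :: "(real \<Rightarrow> real) \<Rightarrow> real \<Rightarrow> real" where
  "el_map \<rho> \<equiv> gibbs M (potential \<rho>)"

abbreviation el_defect :: "(real \<Rightarrow> real) \<Rightarrow> real" where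
  "el_defect \<rho> \<equiv> \<integral>x. rel_ent (\<rho> x) (el_map \<rho> x) \<partial>torus"

lemma global_minimizer_iff:
  "global_minimizer \<beta> M W \<rho> \<longleftrightarrow>
     \<rho> \<in> admissible M \<and> (\<forall>\<sigma>\<in>admissible M. free_energy \<beta> W \<rho> \<le> free_energy \<beta> W \<sigma>)"
  by (auto simp: global_minimizer_def is_arg_min_linorder)

lemma potential_periodic: "periodic_fun_simple' (potential \<rho>)"
  using conv_periodic[of \<rho>] by (simp add: periodic_fun_simple'_def)

lemma potential_continuous: "integrable torus \<rho> \<Longrightarrow> continuous_on UNIV (potential \<rho>)"
  by (intro continuous_intros conv_continuous)

lemma el_map_admissible: "integrable torus \<rho> \<Longrightarrow> el_map \<rho> \<in> admissible M"
  by (intro gibbs_admissible potential_periodic potential_continuous M_pos)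

lemma el_map_pos: "integrable torus \<rho> \<Longrightarrow> 0 < el_map \<rho> x"
  by (intro gibbs_pos potential_periodic potential_continuous M_pos)

lemma el_map_continuous: "integrable torus \<rho> \<Longrightarrow> continuous_on UNIV (el_map \<rho>)"
  by (intro gibbs_continuous potential_periodic potential_continuous M_pos)

lemma el_map_periodic: "integrable torus \<rho> \<Longrightarrow> periodic_fun_simple' (el_map \<rho>)"
  by (intro gibbs_periodic potential_periodic potential_continuous M_pos)

text \<open>
  The Gibbs density of the potential of \<^term>\<open>\<rho>\<close> minimizes the functional obtained by linearizing
  the interaction at \<^term>\<open>\<rho>\<close>; the entropy is convex along the segment.
\<close>
lemma free_energy_segment:
  assumes \<rho>: "\<rho> \<in> admissible M" and t: "0 \<le> t" "t \<le> 1"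
  shows "free_energy \<beta> W (\<lambda>x. (1 - t) * \<rho> x + t * el_map \<rho> x) \<le>
    free_energy \<beta> W \<rho> - t * el_defect \<rho>
      + \<beta> * t\<^sup>2 * (bound * (\<integral>x. \<bar>el_map \<rho> x - \<rho> x\<bar> \<partial>torus)\<^sup>2)"
proof -
  define \<sigma> where "\<sigma> = el_map \<rho>"
  define D where "D x = 1 * \<sigma> x + (-1) * \<rho> x" for x
  note r = admissibleD[OF \<rho>]
  have \<sigma>: "\<sigma> \<in> admissible M" unfolding \<sigma>_def by (rule el_map_admissible[OF r(2)])
  note s = admissibleD[OF \<sigma>]
  have D: "integrable torus D" unfolding D_def using r s by simp
  have defect: "el_defect \<rho> = entropy \<rho> - entropy \<sigma> + 2 * \<beta> * interaction W D \<rho>"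
  proof -
    have "(\<integral>x. (\<rho> x - \<sigma> x) * potential \<rho> x \<partial>torus) = (\<integral>x. (- 2 * \<beta>) * (D x * torus_conv W \<rho> x) \<partial>torus)"
      by (simp add: D_def algebra_simps)
    also have "\<dots> = - 2 * \<beta> * interaction W D \<rho>"
      by (simp add: interaction_def)
    finally show ?thesis
      using rel_ent_gibbs[OF potential_periodic potential_continuous M_pos \<rho>, OF r(2)]
      unfolding \<sigma>_def by simp
  qed
  have mix: "(\<lambda>x. (1 - t) * \<rho> x + t * \<sigma> x) = (\<lambda>x. 1 * \<rho> x + t * D x)"
    by (simp add: D_def algebra_simps)
  have "interaction W (\<lambda>x. 1 * \<rho> x + t * D x) (\<lambda>x. 1 * \<rho> x + t * D x) =
      interaction W \<rho> \<rho> + 2 * t * interaction W D \<rho> + t\<^sup>2 * interaction W D D"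
    using r(2) D by (simp add: interaction_lincomb_left[of \<rho> D _ 1, simplified]
        interaction_lincomb_right[of \<rho> D _ 1, simplified]
        interaction_commute[of \<rho> D] power2_eq_square algebra_simps)
  hence "free_energy \<beta> W (\<lambda>x. (1 - t) * \<rho> x + t * \<sigma> x) \<le> (1 - t) * entropy \<rho> + t * entropy \<sigma>
      - \<beta> * (interaction W \<rho> \<rho> + 2 * t * interaction W D \<rho> + t\<^sup>2 * interaction W D D)"
    using entropy_mix[OF \<rho> \<sigma> t] unfolding free_energy_eq mix by simp
  also have "\<dots> = free_energy \<beta> W \<rho> - t * el_defect \<rho> + \<beta> * t\<^sup>2 * (- interaction W D D)"
    unfolding defect free_energy_eq by (simp add: algebra_simps)
  \<comment> \<open>The quadratic form may have either sign, so the second-order term is estimated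
    in absolute value by the sup norm of the kernel.\<close>
  also have "- interaction W D D \<le> bound * (\<integral>x. \<bar>D x\<bar> \<partial>torus)\<^sup>2"
    using interaction_bound[OF D D] by (simp add: power2_eq_square mult.assoc abs_le_iff)
  hence "\<beta> * t\<^sup>2 * (- interaction W D D) \<le> \<beta> * t\<^sup>2 * (bound * (\<integral>x. \<bar>D x\<bar> \<partial>torus)\<^sup>2)"
    using \<beta>_pos by (intro mult_left_mono) auto
  finally show ?thesis by (simp add: D_def \<sigma>_def)
qed

lemma el_map_dist_le:
  assumes \<rho>: "\<rho> \<in> admissible M"
  shows "(\<integral>x. \<bar>el_map \<rho> x - \<rho> x\<bar> \<partial>torus) \<le> 2 * M"
proof -
  note r = admissibleD[OF \<rho>] and s = admissibleD[OF el_map_admissible[OF admissibleD(2)[OF \<rho>]]]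
  have "(\<integral>x. \<bar>el_map \<rho> x - \<rho> x\<bar> \<partial>torus) \<le> (\<integral>x. \<bar>el_map \<rho> x\<bar> + \<bar>\<rho> x\<bar> \<partial>torus)"
    using r s by (intro integral_mono) auto
  also have "\<dots> = 2 * M"
    using r s by (subst Bochner_Integration.integral_add) auto
  finally show ?thesis .
qed

text \<open>\<open>diff_le_rel_ent\<close> integrated; the factor 2 * M is the total mass of the two
  densities.\<close>

lemma el_map_dist_le_defect:
  assumes \<rho>: "\<rho> \<in> admissible M" and "0 < \<delta>"
  shows "(\<integral>x. \<bar>el_map \<rho> x - \<rho> x\<bar> \<partial>torus) \<le> el_defect \<rho> / \<delta> + \<delta> * (2 * M)"
proof -
  note r = admissibleD[OF \<rho>] and s = admissibleD[OF el_map_admissible[OF admissibleD(2)[OF \<rho>]]]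
  note int = rel_ent_gibbs_integrable[OF potential_periodic potential_continuous M_pos \<rho>, OF r(2)]
  have "(\<integral>x. \<bar>el_map \<rho> x - \<rho> x\<bar> \<partial>torus) \<le> (\<integral>x. rel_ent (\<rho> x) (el_map \<rho> x) / \<delta> + \<delta> * (\<rho> x + el_map \<rho> x) \<partial>torus)"
  proof (rule integral_mono_AE)
    show "AE x in torus. \<bar>el_map \<rho> x - \<rho> x\<bar> \<le> rel_ent (\<rho> x) (el_map \<rho> x) / \<delta> + \<delta> * (\<rho> x + el_map \<rho> x)"
      using r(3)
    proof eventually_elim
      fix x assume "0 \<le> \<rho> x"
      thus "\<bar>el_map \<rho> x - \<rho> x\<bar> \<le> rel_ent (\<rho> x) (el_map \<rho> x) / \<delta> + \<delta> * (\<rho> x + el_map \<rho> x)"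
        using diff_le_rel_ent[OF _ el_map_pos[OF r(2)] \<open>0 < \<delta>\<close>] by (simp add: abs_minus_commute)
    qed
  qed (use int r s in auto)
  also have "\<dots> = el_defect \<rho> / \<delta> + \<delta> * (2 * M)"
    using int r s by (subst Bochner_Integration.integral_add) (auto simp: Bochner_Integration.integral_add)
  finally show ?thesis .
qed

lemma el_defect_nonneg:
  assumes \<rho>: "\<rho> \<in> admissible M"
  shows "0 \<le> el_defect \<rho>"
proof (rule integral_nonneg_AE)
  show "AE x in torus. 0 \<le> rel_ent (\<rho> x) (el_map \<rho> x)"
    using admissibleD(3)[OF \<rho>]
    by eventually_elim (rule rel_ent_nonneg[OF _ el_map_pos[OF admissibleD(2)[OF \<rho>]]])
qed

text \<open>The mixture on the segment is admissible, so its energy is at least I. Hence the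
  first-order gain is at most the excess energy plus the quadratic error; divide by t.\<close>

lemma el_defect_bound:
  assumes \<rho>: "\<rho> \<in> admissible M" and lower: "\<And>\<sigma>. \<sigma> \<in> admissible M \<Longrightarrow> I \<le> free_energy \<beta> W \<sigma>"
    and t: "0 < t" "t \<le> 1"
  shows "el_defect \<rho> \<le> (free_energy \<beta> W \<rho> - I) / t + \<beta> * bound * (2 * M)\<^sup>2 * t"
proof -
  note \<sigma> = el_map_admissible[OF admissibleD(2)[OF \<rho>]]
  have "(\<integral>x. \<bar>el_map \<rho> x - \<rho> x\<bar> \<partial>torus)\<^sup>2 \<le> (2 * M)\<^sup>2"
    by (rule power_mono[OF el_map_dist_le[OF \<rho>]]) simp
  hence "\<beta> * t\<^sup>2 * (bound * (\<integral>x. \<bar>el_map \<rho> x - \<rho> x\<bar> \<partial>torus)\<^sup>2) \<le> \<beta> * t\<^sup>2 * (bound * (2 * M)\<^sup>2)"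
    using \<beta>_pos bound_nonneg by (intro mult_left_mono) auto
  hence "t * el_defect \<rho> \<le> free_energy \<beta> W \<rho> - I + \<beta> * t\<^sup>2 * (bound * (2 * M)\<^sup>2)"
    using free_energy_segment[OF \<rho>, of t] lower[OF admissible_mix[OF \<rho> \<sigma>, of t]] t by simp
  thus ?thesis using t by (simp add: field_simps power2_eq_square)
qed

text \<open>With zero excess energy the defect is at most C t for every t in (0, 1], hence zero, and
  a vanishing divergence forces equality almost everywhere.\<close>

lemma minimizer_euler_lagrange:
  assumes "global_minimizer \<beta> M W \<rho>"
  shows "AE x in torus. \<rho> x = el_map \<rho> x"
proof -
  have \<rho>: "\<rho> \<in> admissible M" and min: "\<And>\<sigma>. \<sigma> \<in> admissible M \<Longrightarrow> free_energy \<beta> W \<rho> \<le> free_energy \<beta> W \<sigma>"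
    using assms by (auto simp: global_minimizer_iff)
  note r = admissibleD[OF \<rho>]
  define C where "C = \<beta> * bound * (2 * M)\<^sup>2"
  have C: "0 \<le> C" using \<beta>_pos bound_nonneg by (simp add: C_def)
  have le: "el_defect \<rho> \<le> C * t" if "0 < t" "t \<le> 1" for t
    using el_defect_bound[OF \<rho> min that] by (simp add: C_def)
  have "el_defect \<rho> \<le> 0"
  proof (rule field_le_epsilon)
    fix e :: real assume e: "0 < e"
    \<comment> \<open>This t stays in (0, 1] and makes C t at most e, also when C = 0.\<close>
    have "C * min 1 (e / (C + 1)) \<le> C * (e / (C + 1))"
      using C by (intro mult_left_mono) auto
    also have "\<dots> \<le> e" using C e by (simp add: field_simps)
    finally show "el_defect \<rho> \<le> 0 + e"
      using le[of "min 1 (e / (C + 1))"] C e by simp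
  qed
  hence "el_defect \<rho> = 0" using el_defect_nonneg[OF \<rho>] by simp
  hence "AE x in torus. rel_ent (\<rho> x) (el_map \<rho> x) = 0"
    using rel_ent_gibbs_integrable[OF potential_periodic potential_continuous M_pos \<rho>, OF r(2)]
      r(3) el_map_pos[OF r(2)] rel_ent_nonneg
    by (subst (asm) integral_nonneg_eq_0_iff_AE) auto
  with r(3) show ?thesis
    by eventually_elim (use rel_ent_eq_0 el_map_pos[OF r(2)] in blast)
qed

text \<open>For fixed small t the excess over t tends to 0, so the defects vanish in the limit, and
  with them the L1 distances. These control the energy at the end t = 1 of the segment.\<close>

lemma free_energy_el_map_tendsto:
  assumes \<rho>: "\<And>n. \<rho> n \<in> admissible M" and lower: "\<And>\<sigma>. \<sigma> \<in> admissible M \<Longrightarrow> I \<le> free_energy \<beta> W \<sigma>"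
    and lim: "(\<lambda>n. free_energy \<beta> W (\<rho> n)) \<longlonglongrightarrow> I"
  shows "(\<lambda>n. free_energy \<beta> W (el_map (\<rho> n))) \<longlonglongrightarrow> I"
proof -
  define C where "C = \<beta> * bound * (2 * M)\<^sup>2"
  have C: "0 \<le> C" using \<beta>_pos bound_nonneg by (simp add: C_def)
  have defect: "(\<lambda>n. el_defect (\<rho> n)) \<longlonglongrightarrow> 0"
  proof (rule order_tendstoI)
    fix e :: real assume "e < 0"
    thus "eventually (\<lambda>n. e < el_defect (\<rho> n)) sequentially"
      by (intro always_eventually allI less_le_trans[OF _ el_defect_nonneg[OF \<rho>]])
  next
    fix e :: real assume e: "0 < e"
    define t where "t = min 1 (e / (C + 1))"
    have t: "0 < t" "t \<le> 1" using C e by (auto simp: t_def)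
    have "C * t \<le> C * (e / (C + 1))"
      unfolding t_def using C by (intro mult_left_mono) auto
    also have "\<dots> < e" using C e by (simp add: field_simps)
    finally have Ct: "C * t < e" .
    have "(\<lambda>n. (free_energy \<beta> W (\<rho> n) - I) / t + C * t) \<longlonglongrightarrow> (I - I) / t + C * t"
      using t by (intro tendsto_intros lim) auto
    hence "eventually (\<lambda>n. (free_energy \<beta> W (\<rho> n) - I) / t + C * t < e) sequentially"
      using Ct by (auto dest: order_tendstoD)
    thus "eventually (\<lambda>n. el_defect (\<rho> n) < e) sequentially"
      by eventually_elim (use el_defect_bound[OF \<rho> lower t] in \<open>unfold C_def, blast intro: le_less_trans\<close>)
  qed
  define d where "d n = (\<integral>x. \<bar>el_map (\<rho> n) x - \<rho> n x\<bar> \<partial>torus)" for n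
  have d: "d \<longlonglongrightarrow> 0"
  proof (rule order_tendstoI)
    fix e :: real assume "e < 0"
    moreover have "0 \<le> d n" for n by (simp add: d_def)
    ultimately show "eventually (\<lambda>n. e < d n) sequentially"
      by (intro always_eventually allI) (rule less_le_trans)
  next
    fix e :: real assume e: "0 < e"
    \<comment> \<open>Chosen so that \<delta> * (2 * M) is e / 2.\<close>
    define \<delta> where "\<delta> = e / (4 * M)"
    have \<delta>: "0 < \<delta>" "\<delta> * (2 * M) < e" using e M_pos by (auto simp: \<delta>_def field_simps)
    have "(\<lambda>n. el_defect (\<rho> n) / \<delta> + \<delta> * (2 * M)) \<longlonglongrightarrow> 0 / \<delta> + \<delta> * (2 * M)"
      using \<delta> by (intro tendsto_intros defect) auto
    hence "eventually (\<lambda>n. el_defect (\<rho> n) / \<delta> + \<delta> * (2 * M) < e) sequentially"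
      using \<delta> by (auto dest: order_tendstoD)
    thus "eventually (\<lambda>n. d n < e) sequentially"
      by eventually_elim (use el_map_dist_le_defect[OF \<rho> \<delta>(1)] in \<open>unfold d_def, blast intro: le_less_trans\<close>)
  qed
  show ?thesis
  proof (rule tendsto_sandwich)
    show "eventually (\<lambda>n. I \<le> free_energy \<beta> W (el_map (\<rho> n))) sequentially"
      using lower el_map_admissible \<rho> admissibleD(2) by (intro always_eventually) blast
    \<comment> \<open>The segment estimate at t = 1, with the nonnegative defect discarded.\<close>
    have "free_energy \<beta> W (el_map (\<rho> n)) \<le> free_energy \<beta> W (\<rho> n) + \<beta> * (bound * (d n)\<^sup>2)" for n
      using free_energy_segment[OF \<rho>, of 1 n] el_defect_nonneg[OF \<rho>, of n] by (simp add: d_def)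
    thus "eventually (\<lambda>n. free_energy \<beta> W (el_map (\<rho> n)) \<le> free_energy \<beta> W (\<rho> n) + \<beta> * (bound * (d n)\<^sup>2)) sequentially"
      by simp
    have "(\<lambda>n. free_energy \<beta> W (\<rho> n) + \<beta> * (bound * (d n)\<^sup>2)) \<longlonglongrightarrow> I + \<beta> * (bound * 0\<^sup>2)"
      by (intro tendsto_intros lim d)
    thus "(\<lambda>n. free_energy \<beta> W (\<rho> n) + \<beta> * (bound * (d n)\<^sup>2)) \<longlonglongrightarrow> I" by simp
  qed (rule tendsto_const)
qed

end

text \<open>Expresses the entropy through u and the partition function, so that its convergence
  follows from that of u.\<close>

lemma entropy_gibbs:
  assumes u: "periodic_fun_simple' u" "continuous_on UNIV u" and M: "0 < M"
  shows "entropy (gibbs M u) =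
    (\<integral>x. gibbs M u x * u x \<partial>torus) + (ln (M / (\<integral>x. exp (u x) \<partial>torus)) - 1) * M"
proof -
  define c where "c = ln (M / (\<integral>x. exp (u x) \<partial>torus))"
  note s = admissibleD[OF gibbs_admissible[OF u M]]
  obtain B where B: "\<And>x. \<bar>u x\<bar> \<le> B"
    using periodic_continuous_bounded[OF u] by blast
  have int: "integrable torus (\<lambda>x. gibbs M u x * u x)"
    by (rule torus_integrable_mult_bounded[OF s(2) continuous_measurable_torus[OF u(2)] B])
  have "entropy (gibbs M u) = (\<integral>x. gibbs M u x * u x + (c - 1) * gibbs M u x \<partial>torus)"
    unfolding entropy_def ln_gibbs[OF u M] by (simp add: c_def algebra_simps)
  also have "\<dots> = (\<integral>x. gibbs M u x * u x \<partial>torus) + (c - 1) * M"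
    using int s by (subst Bochner_Integration.integral_add) auto
  finally show ?thesis unfolding c_def .
qed

lemma
  assumes u: "\<And>n. continuous_on UNIV (u n)" and v: "continuous_on UNIV v"
    and lim: "\<And>x. (\<lambda>n. u n x) \<longlonglongrightarrow> v x" and B: "\<And>n x. \<bar>u n x\<bar> \<le> B"
  shows integral_exp_tendsto: "(\<lambda>n. \<integral>x. exp (u n x) \<partial>torus) \<longlonglongrightarrow> (\<integral>x. exp (v x) \<partial>torus)"
    and gibbs_tendsto: "(\<lambda>n. gibbs M (u n) x) \<longlonglongrightarrow> gibbs M v x"
proof -
  show *: "(\<lambda>n. \<integral>x. exp (u n x) \<partial>torus) \<longlonglongrightarrow> (\<integral>x. exp (v x) \<partial>torus)"
  proof (rule torus_dominated_convergence)
    show "\<bar>exp (u n x)\<bar> \<le> exp B" for n x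
      using B[of n x] by (simp add: abs_le_iff)
  qed (auto intro!: continuous_measurable_torus continuous_intros tendsto_intros u v lim)
  show "(\<lambda>n. gibbs M (u n) x) \<longlonglongrightarrow> gibbs M v x"
    unfolding gibbs_def using integral_exp_torus_pos[OF v]
    by (intro tendsto_intros * lim) auto
qed

text \<open>The bound depends on u only through B and so dominates a whole sequence of Gibbs
  densities.\<close>

lemma gibbs_bound:
  assumes u: "continuous_on UNIV u" and M: "0 < M" and B: "\<And>x. \<bar>u x\<bar> \<le> B"
  shows "\<bar>gibbs M u x\<bar> \<le> M / exp (- B) * exp B"
proof -
  have "(\<integral>x. exp (- B) \<partial>torus) \<le> (\<integral>x. exp (u x) \<partial>torus)"
    using B by (intro integral_mono integrable_exp_torus u) (auto simp: abs_le_iff minus_le_iff)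
  hence Z: "exp (- B) \<le> (\<integral>x. exp (u x) \<partial>torus)"
    by (simp add: measure_torus)
  have "M / (\<integral>x. exp (u x) \<partial>torus) * exp (u x) \<le> M / exp (- B) * exp B"
    using Z M B[of x] integral_exp_torus_pos[OF u]
    by (intro mult_mono divide_left_mono) (auto simp: abs_le_iff)
  moreover have "0 \<le> M / (\<integral>x. exp (u x) \<partial>torus) * exp (u x)"
    using M by simp
  ultimately show ?thesis unfolding gibbs_def by simp
qed

section \<open>Compactness of the potentials and existence of a minimizer\<close>

context free_energy_problem
begin

text \<open>Uniformly bounded potentials give uniformly bounded densities, so dominated convergence
  handles the entropy, the inner convolution and the outer integral in turn.\<close>

lemma free_energy_gibbs_tendsto:
  assumes u: "\<And>n. periodic_fun_simple' (u n)" "\<And>n. continuous_on UNIV (u n)"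
    and v: "periodic_fun_simple' v" "continuous_on UNIV v"
    and lim: "\<And>x. (\<lambda>n. u n x) \<longlonglongrightarrow> v x" and B: "\<And>n x. \<bar>u n x\<bar> \<le> B"
  shows "(\<lambda>n. free_energy \<beta> W (gibbs M (u n))) \<longlonglongrightarrow> free_energy \<beta> W (gibbs M v)"
proof -
  define G where "G = M / exp (- B) * exp B"
  have G: "\<bar>gibbs M (u n) x\<bar> \<le> G" for n x
    unfolding G_def by (rule gibbs_bound[OF u(2) M_pos B])
  hence G0: "0 \<le> G" using abs_ge_zero order_trans by blast
  note s = gibbs_admissible[OF u M_pos] and sc = gibbs_continuous[OF u M_pos]
  note s' = gibbs_admissible[OF v M_pos] and sc' = gibbs_continuous[OF v M_pos]
  note glim = gibbs_tendsto[OF u(2) v(2) lim B, of M]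
  have "(\<lambda>n. \<integral>x. gibbs M (u n) x * u n x \<partial>torus) \<longlonglongrightarrow> (\<integral>x. gibbs M v x * v x \<partial>torus)"
  proof (rule torus_dominated_convergence)
    show "\<bar>gibbs M (u n) x * u n x\<bar> \<le> G * B" for n x
      unfolding abs_mult using G B G0 by (intro mult_mono) auto
  qed (auto intro!: continuous_measurable_torus continuous_intros tendsto_intros glim lim u v sc sc')
  moreover have "0 < M / (\<integral>x. exp (v x) \<partial>torus)" 
    using M_pos integral_exp_torus_pos[OF v(2)] by simp
  hence "(\<lambda>n. ln (M / (\<integral>x. exp (u n x) \<partial>torus))) \<longlonglongrightarrow> ln (M / (\<integral>x. exp (v x) \<partial>torus))"
    using integral_exp_torus_pos[OF v(2)]
    by (intro tendsto_ln tendsto_divide tendsto_const integral_exp_tendsto[OF u(2) v(2) lim B]) auto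
  ultimately have ent: "(\<lambda>n. entropy (gibbs M (u n))) \<longlonglongrightarrow> entropy (gibbs M v)"
    unfolding entropy_gibbs[OF u M_pos] entropy_gibbs[OF v M_pos]
    by (intro tendsto_add tendsto_mult tendsto_diff tendsto_const)
  have conv: "(\<lambda>n. torus_conv W (gibbs M (u n)) x) \<longlonglongrightarrow> torus_conv W (gibbs M v) x" for x
    unfolding torus_conv_def
  proof (rule torus_dominated_convergence)
    show "\<bar>W (x - y) * gibbs M (u n) y\<bar> \<le> bound * G" for n y
      unfolding abs_mult using G le_bound bound_nonneg by (intro mult_mono) auto
  qed (intro borel_measurable_times conv_measurable continuous_measurable_torus[OF sc]
      continuous_measurable_torus[OF sc'] tendsto_intros glim)+
  have "(\<lambda>n. interaction W (gibbs M (u n)) (gibbs M (u n))) \<longlonglongrightarrow> interaction W (gibbs M v) (gibbs M v)"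
    unfolding interaction_def
  proof (rule torus_dominated_convergence)
    show "\<bar>gibbs M (u n) x * torus_conv W (gibbs M (u n)) x\<bar> \<le> G * (bound * M)" for n x
      unfolding abs_mult using G G0 conv_bound[OF admissibleD(2)[OF s]] admissibleD(6)[OF s]
      by (intro mult_mono) auto
  qed (auto intro!: continuous_measurable_torus continuous_intros conv_continuous tendsto_intros glim conv
      sc sc' admissibleD(2)[OF s] admissibleD(2)[OF s'])
  with ent show ?thesis
    unfolding free_energy_eq by (intro tendsto_intros)
qed

text \<open>All densities have L1 norm M, so their convolutions share one bound and one modulus of
  continuity.\<close>

lemma conv_compactness:
  fixes \<rho> :: "nat \<Rightarrow> real \<Rightarrow> real"
  assumes \<rho>: "\<And>n. \<rho> n \<in> admissible M"
  shows "\<exists>r u. strict_mono (r :: nat \<Rightarrow> nat) \<and> periodic_fun_simple' u \<and> continuous_on UNIV u \<and>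
    (\<forall>x. (\<lambda>n. torus_conv W (\<rho> (r n)) x) \<longlonglongrightarrow> u x)"
proof -
  note int = admissibleD(2)[OF \<rho>] and L1 = admissibleD(6)[OF \<rho>]
  have equi: "\<exists>d>0. \<forall>n y. \<bar>x - y\<bar> < d \<longrightarrow> \<bar>torus_conv W (\<rho> n) x - torus_conv W (\<rho> n) y\<bar> \<le> e" if "0 < e" for x e
  proof -
    have "0 < e / M" using that M_pos by simp
    then obtain d where "0 < d" "\<And>n y. \<bar>x - y\<bar> < d \<Longrightarrow>
        \<bar>torus_conv W (\<rho> n) x - torus_conv W (\<rho> n) y\<bar> \<le> e / M * (\<integral>z. \<bar>\<rho> n z\<bar> \<partial>torus)"
      using conv_equicontinuous int by metis
    thus ?thesis using L1 M_pos by auto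
  qed
  have bdd: "norm (torus_conv W (\<rho> n) x) \<le> bound * M" for n x
    using conv_bound[OF int, of n x] L1 by simp
  have equi': "\<exists>d>0. \<forall>n y. y \<in> {-1/2..1/2} \<and> norm (x - y) < d \<longrightarrow> norm (torus_conv W (\<rho> n) x - torus_conv W (\<rho> n) y) < e"
    if e: "0 < e" for x e
  proof -
    obtain d where "0 < d" "\<And>n y. \<bar>x - y\<bar> < d \<Longrightarrow> \<bar>torus_conv W (\<rho> n) x - torus_conv W (\<rho> n) y\<bar> \<le> e / 2"
      using equi[OF half_gt_zero[OF e], of x] by blast
    moreover have "e / 2 < e" using e by simp
    ultimately show ?thesis by (metis le_less_trans real_norm_def)
  qed
  have "\<exists>g (r :: nat \<Rightarrow> nat). strict_mono r \<and> (\<forall>e>0. \<exists>N. \<forall>n x. n \<ge> N \<and> x \<in> {-1/2..1/2} \<longrightarrow>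
      norm (torus_conv W (\<rho> (r n)) x - g x) < e)"
  proof (rule Arzela_Ascoli[of "{-1/2..1/2}" "\<lambda>n. torus_conv W (\<rho> n)", OF compact_Icc bdd equi'])
    fix g and k :: "nat \<Rightarrow> nat"
    assume "strict_mono k" "\<And>e. 0 < e \<Longrightarrow> \<exists>N. \<forall>n x. n \<ge> N \<and> x \<in> {-1/2..1/2} \<longrightarrow>
      norm (torus_conv W (\<rho> (k n)) x - g x) < e"
    thus ?thesis by blast
  qed
  then obtain g and r :: "nat \<Rightarrow> nat" where r: "strict_mono r"
    and lim: "\<And>e. 0 < e \<Longrightarrow> \<exists>N. \<forall>n x. n \<ge> N \<and> x \<in> {-1/2..1/2} \<longrightarrow> norm (torus_conv W (\<rho> (r n)) x - g x) < e"
    by blast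
  \<comment> \<open>The limit on the closed interval is extended periodically. Continuity of
    \<open>u\<close>, also across the half-integers, comes from the equicontinuity of the
    sequence.\<close>
  define u where "u x = g (torus_rep x)" for x
  have u: "(\<lambda>n. torus_conv W (\<rho> (r n)) x) \<longlonglongrightarrow> u x" for x
  proof -
    have "(\<lambda>n. torus_conv W (\<rho> (r n)) (torus_rep x)) \<longlonglongrightarrow> g (torus_rep x)"
    proof (rule LIMSEQ_I)
      fix e :: real assume "0 < e"
      moreover have "torus_rep x \<in> {-1/2..1/2}" using torus_rep_in[of x] by auto
      ultimately show "\<exists>N. \<forall>n\<ge>N. norm (torus_conv W (\<rho> (r n)) (torus_rep x) - g (torus_rep x)) < e"
        using lim by blast
    qed
    thus ?thesis by (simp add: u_def periodic_torus_rep[OF conv_periodic])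
  qed
  have "u (x + 1) = u x" for x
    using u[of "x + 1"] u[of x] periodic_fun_simple'.plus_period[OF conv_periodic, of _ x]
    by (simp add: LIMSEQ_unique)
  hence "periodic_fun_simple' u" by unfold_locales
  moreover have "continuous_on UNIV u"
    unfolding continuous_on_iff dist_real_def
  proof (intro ballI allI impI)
    fix x e :: real assume e: "0 < e"
    obtain d where d: "0 < d" "\<And>n y. \<bar>x - y\<bar> < d \<Longrightarrow> \<bar>torus_conv W (\<rho> n) x - torus_conv W (\<rho> n) y\<bar> \<le> e / 2"
      using equi[OF half_gt_zero[OF e], of x] by blast
    have "\<bar>u x - u y\<bar> \<le> e / 2" if "\<bar>x - y\<bar> < d" for y
      by (rule LIMSEQ_le_const2[OF tendsto_rabs[OF tendsto_diff[OF u u]]]) (use d(2) that in blast)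
    thus "\<exists>d>0. \<forall>y\<in>UNIV. \<bar>y - x\<bar> < d \<longrightarrow> \<bar>u y - u x\<bar> < e"
      using d(1) e by (intro exI[of _ d]) (force simp: abs_minus_commute)
  qed
  ultimately show ?thesis using r u by blast
qed

text \<open>The subsequence and the limit of the convolutions are part of the conclusion: the
  perturbation argument identifies the minimizer with the limit of its own sequence through
  them.\<close>

lemma minimizing_sequence_limit:
  fixes \<rho> :: "nat \<Rightarrow> real \<Rightarrow> real"
  assumes \<rho>: "\<And>n. \<rho> n \<in> admissible M" and lower: "\<And>\<sigma>. \<sigma> \<in> admissible M \<Longrightarrow> I \<le> free_energy \<beta> W \<sigma>"
    and lim: "(\<lambda>n. free_energy \<beta> W (\<rho> n)) \<longlonglongrightarrow> I"
  shows "\<exists>r u. strict_mono (r :: nat \<Rightarrow> nat) \<and> periodic_fun_simple' u \<and> continuous_on UNIV u \<and>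
    (\<forall>x. (\<lambda>n. torus_conv W (\<rho> (r n)) x) \<longlonglongrightarrow> u x) \<and>
    global_minimizer \<beta> M W (gibbs M (\<lambda>x. 2 * \<beta> * u x))"
proof -
  obtain r :: "nat \<Rightarrow> nat" and u where r: "strict_mono r" and u: "periodic_fun_simple' u" "continuous_on UNIV u"
    and conv: "\<And>x. (\<lambda>n. torus_conv W (\<rho> (r n)) x) \<longlonglongrightarrow> u x"
    using conv_compactness[of \<rho>, OF \<rho>] by blast
  have v: "periodic_fun_simple' (\<lambda>x. 2 * \<beta> * u x)" "continuous_on UNIV (\<lambda>x. 2 * \<beta> * u x)"
    using u by (auto simp: periodic_fun_simple'_def intro!: continuous_intros)
  note int = admissibleD(2)[OF \<rho>]
  have "(\<lambda>n. free_energy \<beta> W (el_map (\<rho> (r n)))) \<longlonglongrightarrow> free_energy \<beta> W (gibbs M (\<lambda>x. 2 * \<beta> * u x))"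
  proof (rule free_energy_gibbs_tendsto[OF potential_periodic potential_continuous[OF int] v])
    show "\<bar>potential (\<rho> (r n)) x\<bar> \<le> 2 * \<beta> * (bound * M)" for n x
      using conv_bound[OF int, of "r n" x] admissibleD(6)[OF \<rho>] \<beta>_pos by (simp add: abs_mult)
  qed (intro tendsto_intros conv)
  moreover have "(\<lambda>n. free_energy \<beta> W (el_map (\<rho> (r n)))) \<longlonglongrightarrow> I"
    using LIMSEQ_subseq_LIMSEQ[OF free_energy_el_map_tendsto[of \<rho>, OF \<rho> lower lim] r] by (simp add: o_def)
  ultimately have "free_energy \<beta> W (gibbs M (\<lambda>x. 2 * \<beta> * u x)) = I"
    by (rule LIMSEQ_unique)
  hence "global_minimizer \<beta> M W (gibbs M (\<lambda>x. 2 * \<beta> * u x))"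
    using lower gibbs_admissible[OF v M_pos] by (simp add: global_minimizer_iff)
  thus ?thesis using r u conv by blast
qed

lemma free_energy_lower_bound:
  assumes \<rho>: "\<rho> \<in> admissible M"
  shows "- 1 - \<beta> * (bound * M * M) \<le> free_energy \<beta> W \<rho>"
proof -
  have "interaction W \<rho> \<rho> \<le> bound * M * M"
    using interaction_bound[OF admissibleD(2)[OF \<rho>] admissibleD(2)[OF \<rho>]] admissibleD(6)[OF \<rho>]
    by (simp add: abs_le_iff)
  hence "\<beta> * interaction W \<rho> \<rho> \<le> \<beta> * (bound * M * M)"
    using \<beta>_pos by simp
  thus ?thesis using entropy_ge[OF \<rho>] by (simp add: free_energy_eq)
qed

lemma minimizer_exists: "\<exists>\<rho>. global_minimizer \<beta> M W \<rho>"
proof -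
  define S where "S = free_energy \<beta> W ` admissible M"
  \<comment> \<open>The uniform density, which shows that the infimum is over a nonempty
    set.\<close>
  have "gibbs M (\<lambda>_. 0) \<in> admissible M"
    by (intro gibbs_admissible M_pos continuous_intros) (simp add: periodic_fun_simple'_def)
  hence ne: "S \<noteq> {}" by (auto simp: S_def)
  have bdd: "bdd_below S"
    unfolding S_def using free_energy_lower_bound by (intro bdd_belowI2) auto
  have lower: "Inf S \<le> free_energy \<beta> W \<sigma>" if "\<sigma> \<in> admissible M" for \<sigma>
    using that by (intro cInf_lower[OF _ bdd]) (simp add: S_def)
  have "\<exists>\<sigma>\<in>admissible M. free_energy \<beta> W \<sigma> < Inf S + 1 / real (Suc n)" for n
    using cInf_lessD[OF ne, of "Inf S + 1 / real (Suc n)"] by (auto simp: S_def)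
  then obtain \<rho> where \<rho>: "\<And>n. \<rho> n \<in> admissible M" "\<And>n. free_energy \<beta> W (\<rho> n) < Inf S + 1 / real (Suc n)"
    by metis
  have lim: "(\<lambda>n. free_energy \<beta> W (\<rho> n)) \<longlonglongrightarrow> Inf S"
  proof (rule tendsto_sandwich[where f = "\<lambda>_. Inf S" and h = "\<lambda>n. Inf S + 1 / real (Suc n)"])
    show "(\<lambda>n. Inf S + 1 / real (Suc n)) \<longlonglongrightarrow> Inf S"
      using tendsto_add[OF tendsto_const LIMSEQ_inverse_real_of_nat, of "Inf S"]
      by (simp add: inverse_eq_divide)
    show "eventually (\<lambda>n. Inf S \<le> free_energy \<beta> W (\<rho> n)) sequentially"
      using lower[OF \<rho>(1)] by simp
    show "eventually (\<lambda>n. free_energy \<beta> W (\<rho> n) \<le> Inf S + 1 / real (Suc n)) sequentially"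
      using less_imp_le[OF \<rho>(2)] by simp
  qed (rule tendsto_const)
  show ?thesis
    using minimizing_sequence_limit[of \<rho>, OF \<rho>(1) lower lim] by blast
qed

text \<open>Provides a continuous positive representative. The fixed point equation holds at every
  point because the convolution ignores null sets.\<close>

lemma minimizer_el_map:
  assumes min: "global_minimizer \<beta> M W \<rho>"
  shows "global_minimizer \<beta> M W (el_map \<rho>)" and "el_map (el_map \<rho>) = el_map \<rho>"
proof -
  have \<rho>: "\<rho> \<in> admissible M" using min by (simp add: global_minimizer_iff)
  note int = admissibleD(2)[OF \<rho>]
  note adm = el_map_admissible[OF int] and ae = minimizer_euler_lagrange[OF min]
  have [measurable]: "\<rho> \<in> borel_measurable torus" "el_map \<rho> \<in> borel_measurable torus"
    using int admissibleD(2)[OF adm] by auto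
  have ae': "AE x in torus. el_map \<rho> x = \<rho> x"
    using ae by eventually_elim simp
  have "torus_conv W (el_map \<rho>) = torus_conv W \<rho>"
    using ae' by (intro ext conv_cong_AE) auto
  thus "el_map (el_map \<rho>) = el_map \<rho>" by simp
  have "entropy \<rho> = entropy (el_map \<rho>)"
    unfolding entropy_def using ae
    by (intro integral_cong_AE) (measurable, auto)
  moreover have "interaction W \<rho> \<rho> = interaction W (el_map \<rho>) (el_map \<rho>)"
    using int admissibleD(2)[OF adm] ae by (intro interaction_cong_AE)
  ultimately have "free_energy \<beta> W \<rho> = free_energy \<beta> W (el_map \<rho>)"
    by (simp add: free_energy_eq)
  thus "global_minimizer \<beta> M W (el_map \<rho>)"
    using min adm by (simp add: global_minimizer_iff)
qed

end

section \<open>Two-point symmetrization\<close>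

text \<open>The reflection in a fixes a and a + 1/2 and exchanges the two arcs between them; on one
  of these arcs g is to dominate its mirror image. Weak inequalities make the property stable under
  pointwise limits.\<close>

definition reflection_ordered :: "(real \<Rightarrow> real) \<Rightarrow> bool" where
  "reflection_ordered g \<longleftrightarrow>
     (\<forall>a. (\<forall>t\<in>{0..1/2}. g (a - t) \<le> g (a + t)) \<or> (\<forall>t\<in>{0..1/2}. g (a + t) \<le> g (a - t)))"

lemma integral_pos_continuous:
  fixes f :: "real \<Rightarrow> real"
  assumes "continuous_on {a..b} f" "\<And>x. x \<in> {a..b} \<Longrightarrow> 0 \<le> f x" "c \<in> {a..b}" "0 < f c" "a < b"
  shows "0 < integral {a..b} f"
proof -
  have "integral {a..b} f \<noteq> 0"
    using integral_eq_0_iff[OF assms(1,5,2)] assms(3,4) by force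
  moreover have "0 \<le> integral {a..b} f"
    using assms by (intro Henstock_Kurzweil_Integration.integral_nonneg integrable_continuous_real) auto
  ultimately show ?thesis by linarith
qed

section \<open>The kernel seen by odd densities on a half circle\<close>

context torus_kernel
begin

lemma conv_reflect:
  assumes f: "continuous_on UNIV f"
  shows "torus_conv W (\<lambda>y. f (- y)) x = torus_conv W f (- x)"
proof -
  have "continuous_on UNIV (\<lambda>y. W (- x - y) * f y)"
    by (intro continuous_intros f continuous_on_compose2[OF cont]) simp
  from torus_integral_reflect[OF this] have
    "torus_conv W f (- x) = (\<integral>y. W (- (x - y)) * f (- y) \<partial>torus)"
    by (simp add: torus_conv_def)
  thus ?thesis unfolding even by (simp add: torus_conv_def)
qed

text \<open>Folding replaces W by the difference of its values at a point and at the mirror image, a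
  kernel that \<open>kernel_reflection\<close> shows to be nonnegative on the half circle.\<close>

lemma conv_odd:
  assumes p: "continuous_on UNIV p" "\<And>x. p (- x) = - p x"
  shows "torus_conv W p (- x) = - torus_conv W p x"
    and "torus_conv W p x = integral {0..1/2} (\<lambda>y. (W (x - y) - W (x + y)) * p y)"
proof -
  have "torus_conv W p (- x) = torus_conv W (\<lambda>y. - p y) x"
    using conv_reflect[OF p(1), of x] p(2) by simp
  thus "torus_conv W p (- x) = - torus_conv W p x"
    by (simp add: torus_conv_def)
  have "continuous_on UNIV (\<lambda>y. W (x - y) * p y)"
    by (intro continuous_intros p continuous_on_compose2[OF cont]) simp
  from torus_integral_fold[OF this]
  show "torus_conv W p x = integral {0..1/2} (\<lambda>y. (W (x - y) - W (x + y)) * p y)"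
    by (simp add: torus_conv_def p(2) algebra_simps)
qed

lemma kernel_reflection:
  assumes anti: "strict_antimono_on {0..1/2} W" and x: "0 \<le> x" "x \<le> 1/2" and y: "0 \<le> y" "y \<le> 1/2"
  shows "W (x + y) \<le> W (x - y)"
    and "0 < x \<Longrightarrow> x < 1/2 \<Longrightarrow> 0 < y \<Longrightarrow> y < 1/2 \<Longrightarrow> W (x + y) < W (x - y)"
proof -
  \<comment> \<open>The circle distances from x to y and from x to -y. They agree only when x or y
    is a fixed point 0 or 1/2 of the reflection, so strictness is claimed in the interior.\<close>
  define r s where "r = \<bar>x - y\<bar>" and "s = min (x + y) (1 - (x + y))"
  have rs: "0 \<le> r" "r \<le> s" "s \<le> 1/2" using x y by (auto simp: r_def s_def min_def)
  have Wr: "W (x - y) = W r"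
    using even[of "x - y"] by (simp add: r_def abs_if)
  have "W (x + y) = W (x + y - 1)"
    by (rule periodic_cong_int[OF per, of _ _ 1]) simp
  also have "\<dots> = W (1 - (x + y))" using even[of "x + y - 1"] by simp
  finally have Ws: "W (x + y) = W s" by (simp add: s_def min_def)
  have less: "W s < W r" if "r < s"
    by (rule monotone_onD[OF anti]) (use rs that in auto)
  thus "W (x + y) \<le> W (x - y)"
    unfolding Wr Ws using rs(2) by (cases "r = s") auto
  show "W (x + y) < W (x - y)" if "0 < x" "x < 1/2" "0 < y" "y < 1/2"
    unfolding Wr Ws by (rule less) (use that in \<open>auto simp: r_def s_def min_def\<close>)
qed

end

context free_energy_problem
begin

text \<open>If g - g (- x) takes both signs on the half circle, moving the larger value of each pair
  x, -x there keeps mass and entropy but strictly raises the interaction, contradicting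
  minimality.\<close>

lemma minimizer_ordered_at_0:
  assumes anti: "strict_antimono_on {0..1/2} W"
    and min: "global_minimizer \<beta> M W g" and g: "continuous_on UNIV g" and pos: "\<And>x. 0 < g x"
  shows "(\<forall>t\<in>{0..1/2}. g (- t) \<le> g t) \<or> (\<forall>t\<in>{0..1/2}. g t \<le> g (- t))"
proof -
  have adm: "g \<in> admissible M" using min by (simp add: global_minimizer_iff)
  note per = admissibleD(1)[OF adm]
  have gm: "continuous_on UNIV (\<lambda>x. g (- x))"
    by (intro continuous_on_compose2[OF g] continuous_intros) simp
  define d s where "d x = (g x - g (- x)) / 2" and "s x = (g x + g (- x)) / 2" for x
  \<comment> \<open>The sign of the sine is a periodic selector of the half circle. It jumps only at
    the fixed points 0 and 1/2 modulo 1, where \<open>d\<close> vanishes, so \<open>D\<close> is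
    continuous and odd.\<close>
  define D where "D x = (if 0 \<le> sin (2 * pi * x) then \<bar>d x\<bar> else - \<bar>d x\<bar>)" for x
  define h where "h x = s x + D x" for x
  \<comment> \<open>On [0, 1/2] these are the positive and negative parts of \<open>d\<close>,
    extended as odd functions: D = p + n and d = p - n.\<close>
  define p n where "p x = (D x + d x) / 2" and "n x = (D x - d x) / 2" for x
  have d: "continuous_on UNIV d" and s: "continuous_on UNIV s"
    unfolding d_def s_def using g gm by (auto intro!: continuous_intros)
  have d0: "d x = 0" if zero: "sin (2 * pi * x) = 0" for x
  proof -
    obtain i :: int where "2 * pi * x = of_int i * pi"
      using zero unfolding sin_zero_iff_int2 by blast
    hence "x - (- x) = of_int i" by simp
    thus ?thesis using periodic_cong_int[OF per] by (simp add: d_def)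
  qed
  have D: "continuous_on UNIV D"
  proof -
    have "closed {x::real. 0 \<le> sin (2 * pi * x)}" "closed {x::real. sin (2 * pi * x) \<le> 0}"
      by (intro closed_Collect_le continuous_intros)+
    hence "continuous_on ({x. 0 \<le> sin (2 * pi * x)} \<union> {x. sin (2 * pi * x) \<le> 0}) D"
      unfolding D_def using d0
      by (intro continuous_on_cases continuous_on_subset[OF continuous_on_rabs[OF d]]
          continuous_on_subset[OF continuous_on_minus[OF continuous_on_rabs[OF d]]]) auto
    moreover have "{x. 0 \<le> sin (2 * pi * x)} \<union> {x. sin (2 * pi * x) \<le> 0} = (UNIV :: real set)"
      by auto
    ultimately show ?thesis by simp
  qed
  have d_odd: "d (- x) = - d x" for x
    unfolding d_def by (simp add: minus_divide_left)
  have odd: "d (- x) = - d x" "s (- x) = s x" "D (- x) = - D x" for x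
    using d0[of x] by (auto simp: d_odd s_def D_def)
  have p: "continuous_on UNIV p" "p (- x) = - p x" and n: "continuous_on UNIV n" "n (- x) = - n x" for x
    unfolding p_def n_def using d D odd by (auto intro!: continuous_intros simp: minus_divide_left)
  have h: "continuous_on UNIV h"
    unfolding h_def using s D by (intro continuous_intros)
  \<comment> \<open>\<open>h\<close> only permutes the two values on each pair x, -x, so folded
    integrals of any function of the density are unchanged.\<close>
  have swap: "h x = g x \<and> h (- x) = g (- x) \<or> h x = g (- x) \<and> h (- x) = g x" for x
    unfolding h_def odd unfolding D_def d_def s_def by (auto simp: abs_if field_simps)
  have h_pos: "0 < h x" for x using swap[of x] pos by auto
  have h_per: "periodic_fun_simple' h"
  proof
    fix x
    have "sin (2 * pi * (x + 1)) = sin (2 * pi * x)"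
      by (simp add: distrib_left)
    moreover have "g (x + 1) = g x" "g (- (x + 1)) = g (- x)"
      using periodic_cong_int[OF per, of "x + 1" x 1] periodic_cong_int[OF per, of "- (x + 1)" "- x" "-1"] by auto
    ultimately show "h (x + 1) = h x"
      by (simp only: h_def D_def d_def s_def)
  qed
  have equal: "(\<integral>x. \<phi> (h x) \<partial>torus) = (\<integral>x. \<phi> (g x) \<partial>torus)"
    if "continuous_on {0<..} \<phi>" for \<phi> :: "real \<Rightarrow> real"
  proof -
    have "continuous_on UNIV (\<lambda>x. \<phi> (h x))" "continuous_on UNIV (\<lambda>x. \<phi> (g x))"
      by (rule continuous_on_compose2[OF that]; use h g h_pos pos in auto)+
    moreover have "\<phi> (h t) + \<phi> (h (- t)) = \<phi> (g t) + \<phi> (g (- t))" for t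
      using swap[of t] by auto
    ultimately show ?thesis by (simp add: torus_integral_fold)
  qed
  have hadm: "h \<in> admissible M"
    using equal[of "\<lambda>x. x"] admissibleD(4)[OF adm]
    by (intro admissible_continuous h_per h h_pos) (simp add: continuous_on_id)
  have "entropy h = entropy g"
    unfolding entropy_def by (rule equal[of "\<lambda>r. r * (ln r - 1)"]) (auto intro!: continuous_intros)
  moreover have "free_energy \<beta> W g \<le> free_energy \<beta> W h"
    using min hadm by (simp add: global_minimizer_iff)
  ultimately have energy: "interaction W h h \<le> interaction W g g"
    using \<beta>_pos by (simp add: free_energy_eq)
  define q where "q x = 1 * s x + 1 * p x" for x
  note int = torus_integral_continuous(1)
  have q: "continuous_on UNIV q" unfolding q_def using s p by (intro continuous_intros)
  \<comment> \<open>h = q + n and g = q - n: in the difference of the energies both diagonal terms,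
    whose sign is unknown, cancel and only the cross term survives.\<close>
  have "h = (\<lambda>x. 1 * q x + 1 * n x)" "g = (\<lambda>x. 1 * q x + (-1) * n x)"
    by (auto simp: h_def q_def n_def p_def d_def s_def fun_eq_iff field_simps)
  hence "interaction W h h - interaction W g g = 4 * interaction W n q"
    using interaction_commute[OF int[OF n(1)] int[OF q]]
    by (simp only: interaction_lincomb_left interaction_lincomb_right int q n
        Bochner_Integration.integrable_add Bochner_Integration.integrable_mult_right)
      (simp add: algebra_simps)
  also have "interaction W n q = interaction W n s + interaction W n p"
    unfolding q_def using interaction_lincomb_right[OF int[OF s] int[OF p(1)] int[OF n(1)], of 1 1] by simp
  \<comment> \<open>Parity: \<open>n\<close> is odd, and the convolution of the even kernel with the
    even \<open>s\<close> is even.\<close>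
  also have "interaction W n s = 0"
  proof -
    have "torus_conv W s (- x) = torus_conv W s x" for x
      using conv_reflect[OF s, of x] odd by simp
    moreover have "continuous_on UNIV (\<lambda>x. n x * torus_conv W s x)"
      by (intro continuous_intros n conv_continuous int s)
    ultimately show ?thesis
      unfolding interaction_def by (simp add: torus_integral_fold n)
  qed
  finally have le0: "interaction W n p \<le> 0" using energy by simp
  have "continuous_on UNIV (\<lambda>x. n x * torus_conv W p x)"
    by (intro continuous_intros n conv_continuous int p)
  hence fold: "interaction W n p = integral {0..1/2} (\<lambda>t. 2 * (n t * torus_conv W p t))"
    unfolding interaction_def by (simp add: torus_integral_fold n conv_odd(1)[OF p])
  have D_half: "D t = \<bar>d t\<bar>" if "t \<in> {0..1/2}" for t
  proof -
    have "0 \<le> sin (2 * pi * t)" using that by (intro sin_ge_zero) auto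
    thus ?thesis by (simp add: D_def)
  qed
  hence nonneg: "0 \<le> n t" "0 \<le> p t" if "t \<in> {0..1/2}" for t
    using that by (auto simp: n_def p_def abs_if)
  \<comment> \<open>\<open>d\<close> vanishes at the fixed points, so points where it has a sign lie
    where the kernel inequality is strict.\<close>
  have interior: "0 < t \<and> t < 1/2" if "t \<in> {0..1/2}" "d t \<noteq> 0" for t
  proof -
    have "t \<noteq> 0" "2 * pi * t \<noteq> pi" using d0[of t] that(2) by (metis mult_zero_right sin_zero, metis sin_pi)
    thus ?thesis using that(1) by (auto simp: order_less_le)
  qed
  show ?thesis
  proof (rule ccontr)
    assume "\<not> ?thesis"
    \<comment> \<open>Opposite signs at a and b: n is positive at a and p at b, so the convolution
      of p is positive at a and the cross term is positive.\<close>
    then obtain a b where ab: "a \<in> {0..1/2}" "b \<in> {0..1/2}" "d a < 0" "0 < d b"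
      by (auto simp: d_def not_le)
    have na: "0 < n a" and pb: "0 < p b"
      using ab D_half by (auto simp: n_def p_def)
    have kp: "continuous_on {0..1/2} (\<lambda>y. (W (t - y) - W (t + y)) * p y)" for t
      by (intro continuous_intros continuous_on_compose2[OF cont] continuous_on_subset[OF p(1)]) auto
    have conv_nonneg: "0 \<le> torus_conv W p t" if "t \<in> {0..1/2}" for t
      unfolding conv_odd(2)[OF p]
      using that nonneg kernel_reflection(1)[OF anti, of t]
      by (intro Henstock_Kurzweil_Integration.integral_nonneg integrable_continuous_real kp) auto
    have "0 < torus_conv W p a"
      unfolding conv_odd(2)[OF p]
    proof (rule integral_pos_continuous[OF kp])
      show "0 \<le> (W (a - y) - W (a + y)) * p y" if "y \<in> {0..1/2}" for y
        using that ab nonneg kernel_reflection(1)[OF anti, of a y] by simp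
      show "0 < (W (a - b) - W (a + b)) * p b"
        using kernel_reflection(2)[OF anti, of a b] interior[of a] interior[of b] ab pb by simp
    qed (use ab in auto)
    hence "0 < integral {0..1/2} (\<lambda>t. 2 * (n t * torus_conv W p t))"
      using na ab nonneg conv_nonneg
      by (intro integral_pos_continuous[of _ _ _ a] continuous_intros continuous_on_subset[OF n(1)]
          continuous_on_subset[OF conv_continuous[OF int[OF p(1)]]]) auto
    thus False using le0 fold by simp
  qed
qed

text \<open>Convolution commutes with translation, so both parts of the energy are integrals of
  translated continuous functions. This moves an arbitrary reflection axis to 0.\<close>

lemma minimizer_shift:
  assumes min: "global_minimizer \<beta> M W g" and g: "continuous_on UNIV g" and pos: "\<And>x. 0 < g x"
  shows "global_minimizer \<beta> M W (\<lambda>x. g (x + a))"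
proof -
  have adm: "g \<in> admissible M" using min by (simp add: global_minimizer_iff)
  note per = admissibleD(1)[OF adm]
  define h where "h x = g (x + a)" for x
  have h: "continuous_on UNIV h"
    unfolding h_def by (intro continuous_on_compose2[OF g] continuous_intros) simp
  have hper: "periodic_fun_simple' h"
    unfolding h_def by unfold_locales (rule periodic_cong_int[OF per, of _ _ 1], simp)
  have "(\<integral>x. h x \<partial>torus) = M"
    unfolding h_def using torus_integral_shift[OF per g] admissibleD(4)[OF adm] by simp
  hence hadm: "h \<in> admissible M"
    using hper h pos by (intro admissible_continuous) (auto simp: h_def)
  have "continuous_on UNIV (\<lambda>x. g x * (ln (g x) - 1))"
    using pos by (intro continuous_intros g) (auto simp: less_imp_neq[THEN not_sym])
  moreover have "periodic_fun_simple' (\<lambda>x. g x * (ln (g x) - 1))"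
    by unfold_locales (simp add: periodic_fun_simple'.plus_period[OF per])
  ultimately have "entropy h = entropy g"
    unfolding entropy_def h_def by (intro torus_integral_shift[of "\<lambda>x. g x * (ln (g x) - 1)"])
  moreover have conv: "torus_conv W h x = torus_conv W g (x + a)" for x
  proof -
    have "continuous_on UNIV (\<lambda>y. W (x + a - y) * g y)"
      by (intro continuous_intros g continuous_on_compose2[OF cont]) simp
    moreover have "periodic_fun_simple' (\<lambda>y. W (x + a - y) * g y)"
    proof
      fix y
      have "W (x + a - (y + 1)) = W (x + a - y)"
        by (rule periodic_cong_int[OF torus_kernel.per[OF torus_kernel_axioms], of _ _ "-1"]) simp
      thus "W (x + a - (y + 1)) * g (y + 1) = W (x + a - y) * g y"
        by (simp add: periodic_fun_simple'.plus_period[OF per])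
    qed
    ultimately have "(\<integral>y. W (x + a - (y + a)) * g (y + a) \<partial>torus) = (\<integral>y. W (x + a - y) * g y \<partial>torus)"
      by (intro torus_integral_shift[of "\<lambda>y. W (x + a - y) * g y"])
    thus ?thesis by (simp add: torus_conv_def h_def)
  qed
  have "interaction W h h = interaction W g g"
    unfolding interaction_def conv unfolding h_def
  proof (rule torus_integral_shift[of "\<lambda>x. g x * torus_conv W g x"])
    show "periodic_fun_simple' (\<lambda>x. g x * torus_conv W g x)"
      by unfold_locales (simp add: periodic_fun_simple'.plus_period[OF per]
          periodic_fun_simple'.plus_period[OF conv_periodic])
  qed (intro continuous_intros g conv_continuous admissibleD(2)[OF adm])
  ultimately have "free_energy \<beta> W h = free_energy \<beta> W g"
    by (simp add: free_energy_eq)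
  thus ?thesis
    using min hadm unfolding h_def by (simp add: global_minimizer_iff)
qed

lemma minimizer_reflection_ordered:
  assumes anti: "strict_antimono_on {0..1/2} W"
    and min: "global_minimizer \<beta> M W g" and g: "continuous_on UNIV g" and pos: "\<And>x. 0 < g x"
  shows "reflection_ordered g"
  unfolding reflection_ordered_def
proof
  fix a
  have "continuous_on UNIV (\<lambda>x. g (x + a))"
    by (intro continuous_on_compose2[OF g] continuous_intros) simp
  from minimizer_ordered_at_0[OF anti minimizer_shift[OF min g pos] this pos]
  show "(\<forall>t\<in>{0..1/2}. g (a - t) \<le> g (a + t)) \<or> (\<forall>t\<in>{0..1/2}. g (a + t) \<le> g (a - t))"
    by (simp add: add.commute)
qed

end

section \<open>Continuous functions on the circle ordered by every reflection\<close>

lemma reflection_ordered_limit: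
  assumes "\<And>n. reflection_ordered (f n)" and lim: "\<And>x. (\<lambda>n. f n x) \<longlonglongrightarrow> g x"
  shows "reflection_ordered g"
  unfolding reflection_ordered_def
proof (rule allI, rule ccontr)
  fix a assume "\<not> ((\<forall>t\<in>{0..1/2}. g (a - t) \<le> g (a + t)) \<or> (\<forall>t\<in>{0..1/2}. g (a + t) \<le> g (a - t)))"
  \<comment> \<open>Failure of the dichotomy is witnessed by two strict inequalities, and these
    persist for large n.\<close>
  then obtain s t where st: "s \<in> {0..1/2}" "t \<in> {0..1/2}" "0 < g (a - s) - g (a + s)" "0 < g (a + t) - g (a - t)"
    by (auto simp: not_le)
  have "eventually (\<lambda>n. 0 < f n (a - s) - f n (a + s)) sequentially"
    by (rule order_tendstoD(1)[OF tendsto_diff[OF lim lim] st(3)])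
  moreover have "eventually (\<lambda>n. 0 < f n (a + t) - f n (a - t)) sequentially"
    by (rule order_tendstoD(1)[OF tendsto_diff[OF lim lim] st(4)])
  ultimately have "eventually (\<lambda>n. 0 < f n (a - s) - f n (a + s) \<and> 0 < f n (a + t) - f n (a - t)) sequentially"
    by (rule eventually_conj)
  then obtain n where "f n (a + s) < f n (a - s)" "f n (a - t) < f n (a + t)"
    by (auto simp: eventually_sequentially)
  thus False
    using assms(1)[of n] st(1,2) unfolding reflection_ordered_def by (meson not_le)
qed

lemma closed_ordered_centres:
  fixes f :: "real \<Rightarrow> real"
  assumes f: "continuous_on UNIV f"
  shows "closed {a. \<forall>t\<in>{0..1/2}. f (a - t) \<le> f (a + t)}" (is ?A)
    and "closed {a. \<forall>t\<in>{0..1/2}. f (a + t) \<le> f (a - t)}" (is ?B)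
proof -
  have "continuous_on UNIV (\<lambda>a. f (a - t))" "continuous_on UNIV (\<lambda>a. f (a + t))" for t
    by (intro continuous_on_compose2[OF f] continuous_intros; simp)+
  hence "closed (\<Inter>t\<in>{0..1/2}. {a. f (a - t) \<le> f (a + t)})" "closed (\<Inter>t\<in>{0..1/2}. {a. f (a + t) \<le> f (a - t)})"
    by (intro closed_INT ballI closed_Collect_le; simp)+
  thus ?A ?B by (simp_all add: Collect_ball_eq)
qed

lemma symmetric_centre:
  fixes f :: "real \<Rightarrow> real"
  assumes per: "periodic_fun_simple' f"
    and "\<forall>t\<in>{0..1/2}. f (a - t) \<le> f (a + t)" and "\<forall>t\<in>{0..1/2}. f (a + t) \<le> f (a - t)"
  shows "f (a + t) = f (a - t)"
proof -
  define r where "r = torus_rep t"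
  have eq: "f (a + r) = f (a - r)"
  proof (cases "0 \<le> r")
    case True
    thus ?thesis using assms(2,3) torus_rep_in[of t] by (intro antisym) (auto simp: r_def)
  next
    case False
    hence "- r \<in> {0..1/2}" using torus_rep_in[of t] by (auto simp: r_def)
    with assms(2,3) have "f (a - - r) \<le> f (a + - r)" "f (a + - r) \<le> f (a - - r)"
      by blast+
    thus ?thesis by simp
  qed
  have "f (a + t) = f (a + r)"
    by (rule periodic_cong_int[OF per, of _ _ "\<lceil>t - 1/2\<rceil>"]) (simp add: r_def torus_rep_def)
  moreover have "f (a - t) = f (a - r)"
    by (rule periodic_cong_int[OF per, of _ _ "- \<lceil>t - 1/2\<rceil>"]) (simp add: r_def torus_rep_def)
  ultimately show ?thesis using eq by simp
qed

text \<open>Advancing the axis by 1/2 exchanges the dominating and the dominated arc, so A and B are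
  both nonempty. They are closed and cover the line, hence meet, and a common point is an axis of
  symmetry.\<close>

lemma reflection_ordered_symmetric:
  assumes ord: "reflection_ordered g" and per: "periodic_fun_simple' g" and cont: "continuous_on UNIV g"
  shows "\<exists>a. \<forall>t. g (a + t) = g (a - t)"
proof -
  define A B where "A = {a. \<forall>t\<in>{0..1/2}. g (a - t) \<le> g (a + t)}"
    and "B = {a. \<forall>t\<in>{0..1/2}. g (a + t) \<le> g (a - t)}"
  have cover: "UNIV \<subseteq> A \<union> B" using ord by (auto simp: reflection_ordered_def A_def B_def)
  \<comment> \<open>Distance t from a + 1/2 is distance 1/2 - t from a, on the opposite side modulo
    the period.\<close>
  have swap: "g (a + 1/2 + t) = g (a - (1/2 - t)) \<and> g (a + 1/2 - t) = g (a + (1/2 - t))" for a t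
    by (rule conjI) (rule periodic_cong_int[OF per, of _ _ 1], simp, simp add: algebra_simps)
  have AB: "a \<in> A \<Longrightarrow> a + 1/2 \<in> B" and BA: "a \<in> B \<Longrightarrow> a + 1/2 \<in> A" for a
    unfolding A_def B_def by (auto simp: swap simp del: diff_diff_eq2)
  have "A \<noteq> {}" "B \<noteq> {}"
    using cover AB BA by blast+
  hence "A \<inter> B \<noteq> {}"
    using connected_closedD[OF connected_UNIV, of A B] cover closed_ordered_centres[OF cont]
    unfolding A_def[symmetric] B_def[symmetric] by simp blast
  then obtain a where "a \<in> A" "a \<in> B" by blast
  thus ?thesis using symmetric_centre[OF per, of a] unfolding A_def B_def by blast
qed

text \<open>
  A second axis of symmetry inside (0, 1/2) gives a period of at most 1/2. Then the half circle on
  which f is compared with its reflection contains a full period, and f has to be constant.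
\<close>
lemma reflection_ordered_even:
  fixes f :: "real \<Rightarrow> real"
  assumes ord: "reflection_ordered f" and per: "periodic_fun_simple' f" and cont: "continuous_on UNIV f"
    and even: "\<And>x. f (- x) = f x"
  shows "antimono_on {0..1/2} f \<or> mono_on {0..1/2} f"
proof -
  define A B where "A = {a. \<forall>t\<in>{0..1/2}. f (a - t) \<le> f (a + t)}"
    and "B = {a. \<forall>t\<in>{0..1/2}. f (a + t) \<le> f (a - t)}"
  have cover: "{0<..<1/2} \<subseteq> A \<union> B" using ord by (auto simp: reflection_ordered_def A_def B_def)
  consider "{0<..<1/2} \<subseteq> B" | "{0<..<1/2} \<subseteq> A" | b where "0 < b" "b < 1/2" "b \<in> A" "b \<in> B"
  proof (cases "A \<inter> B \<inter> {0<..<1/2} = {}")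
    case True
    have "connected {0<..<1/2::real}" by simp
    from connected_closedD[OF this True cover]
    have "A \<inter> {0<..<1/2} = {} \<or> B \<inter> {0<..<1/2} = {}"
      using closed_ordered_centres[OF cont] by (simp add: A_def B_def)
    hence "{0<..<1/2} \<subseteq> B \<or> {0<..<1/2} \<subseteq> A" using cover by blast
    thus ?thesis using that(1,2) by blast
  next
    case False
    thus ?thesis using that(3) by auto
  qed
  thus ?thesis
  proof cases
    case 1
    have "antimono_on {0..1/2} f"
    proof (rule monotone_onI)
      fix x y :: real assume xy: "x \<in> {0..1/2}" "y \<in> {0..1/2}" "x \<le> y"
      show "f y \<le> f x"
      proof (cases "x = y")
        case False
        \<comment> \<open>x and y are mirror images in their midpoint b, which lies in the open
          interval since x < y.\<close>
        define b t where "b = (x + y) / 2" and "t = (y - x) / 2"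
        have bt: "b \<in> {0<..<1/2}" "t \<in> {0..1/2}" "x = b - t" "y = b + t"
          using xy False by (auto simp: b_def t_def field_simps)
        thus ?thesis using 1 unfolding B_def by blast
      qed simp
    qed
    thus ?thesis ..
  next
    case 2
    have "mono_on {0..1/2} f"
    proof (rule monotone_onI)
      fix x y :: real assume xy: "x \<in> {0..1/2}" "y \<in> {0..1/2}" "x \<le> y"
      show "f x \<le> f y"
      proof (cases "x = y")
        case False
        define b t where "b = (x + y) / 2" and "t = (y - x) / 2"
        have bt: "b \<in> {0<..<1/2}" "t \<in> {0..1/2}" "x = b - t" "y = b + t"
          using xy False by (auto simp: b_def t_def field_simps)
        thus ?thesis using 2 unfolding A_def by blast
      qed simp
    qed
    thus ?thesis ..
  next
    case 3
    have sym: "f (b + t) = f (b - t)" for t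
      using 3 by (intro symmetric_centre[OF per]) (auto simp: A_def B_def)
    have per_b: "f (s + 2 * b) = f s" for s
      using sym[of "b + s"] even[of s] by (simp add: algebra_simps)
    \<comment> \<open>The reflections in 0 and in b compose to a translation by 2 * b. With period 1
      also 1 - 2 * b is a period, and the smaller of the two is at most 1/2.\<close>
    define P where "P = min (2 * b) (1 - 2 * b)"
    have P: "0 < P" "P \<le> 1/2" using 3 by (auto simp: P_def min_def)
    have perP: "f (s + P) = f s" for s
    proof (cases "2 * b \<le> 1 - 2 * b")
      case True
      thus ?thesis using per_b[of s] by (simp add: P_def)
    next
      case False
      have "f (s + (1 - 2 * b)) = f (s - 2 * b)"
        by (rule periodic_cong_int[OF per, of _ _ 1]) simp
      thus ?thesis using per_b[of "s - 2 * b"] False by (simp add: P_def)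
    qed
    interpret P: periodic_fun_simple f P
      by unfold_locales (rule perP)
    \<comment> \<open>Modulo P, the points at distance P - t from c are those at distance t with the
      sides exchanged. One fixed order at both distances therefore forces equality.\<close>
    have near: "f (c + t) = f (c - t)" if "t \<in> {0..P}" for c t
    proof -
      have t: "t \<in> {0..1/2}" "P - t \<in> {0..1/2}" using that P by auto
      have eq: "f (c - (P - t)) = f (c + t)" "f (c + (P - t)) = f (c - t)"
        using perP[of "c - (P - t)"] perP[of "c - t"] by (simp_all add: algebra_simps)
      from ord have "(\<forall>t\<in>{0..1/2}. f (c - t) \<le> f (c + t)) \<or> (\<forall>t\<in>{0..1/2}. f (c + t) \<le> f (c - t))"
        unfolding reflection_ordered_def by blast
      hence "f (c - t) \<le> f (c + t) \<and> f (c - (P - t)) \<le> f (c + (P - t)) \<or>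
             f (c + t) \<le> f (c - t) \<and> f (c + (P - t)) \<le> f (c - (P - t))"
        using t by blast
      thus ?thesis unfolding eq by linarith
    qed
    have const: "f x = f 0" for x
    proof -
      define k where "k = \<lfloor>x / P\<rfloor>"
      define r where "r = x - of_int k * P"
      have "of_int k \<le> x / P" "x / P < of_int k + 1" unfolding k_def by linarith+
      hence r: "0 \<le> r" "r \<le> P" using P by (simp_all add: r_def field_simps)
      have "f x = f r" using P.minus_of_int[of x k] by (simp add: r_def)
      \<comment> \<open>The reflection in r / 2 exchanges 0 and r.\<close>
      also have "\<dots> = f 0" using near[of "r / 2" "r / 2"] r by simp
      finally show ?thesis .
    qed
    have "f y \<le> f x" for x y using const[of x] const[of y] by simp
    hence "antimono_on {0..1/2} f" by (intro monotone_onI)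
    thus ?thesis ..
  qed
qed

text \<open>An axis of symmetry carries either the maximum or the minimum at its centre; in the
  latter case the antipodal point is taken as the centre.\<close>

lemma reflection_ordered_centre:
  assumes ord: "reflection_ordered g" and per: "periodic_fun_simple' g" and cont: "continuous_on UNIV g"
  shows "\<exists>c. (\<forall>x. g (- x + c) = g (x + c)) \<and> antimono_on {0..1/2} (\<lambda>x. g (x + c))"
proof -
  obtain a where a: "\<And>t. g (a + t) = g (a - t)"
    using reflection_ordered_symmetric[OF assms] by blast
  define f where "f x = g (x + a)" for x
  have even: "f (- x) = f x" for x using a[of x] by (simp add: f_def add.commute)
  have fper: "periodic_fun_simple' f"
    unfolding f_def by unfold_locales (rule periodic_cong_int[OF per, of _ _ 1], simp)
  have "continuous_on UNIV f"
    unfolding f_def by (intro continuous_on_compose2[OF cont] continuous_intros) simp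
  moreover have "reflection_ordered f"
    unfolding reflection_ordered_def
  proof
    fix c
    show "(\<forall>t\<in>{0..1/2}. f (c - t) \<le> f (c + t)) \<or> (\<forall>t\<in>{0..1/2}. f (c + t) \<le> f (c - t))"
      using ord[unfolded reflection_ordered_def, rule_format, of "c + a"]
      by (simp add: f_def algebra_simps)
  qed
  ultimately consider "antimono_on {0..1/2} f" | "mono_on {0..1/2} f"
    using reflection_ordered_even[of f] fper even by blast
  thus ?thesis
  proof cases
    case 1
    thus ?thesis using even unfolding f_def by blast
  next
    case 2
    have refl: "f (x + 1/2) = f (1/2 - x)" for x
    proof -
      have "f (x + 1/2) = f (x - 1/2)"
        by (rule periodic_cong_int[OF fper, of _ _ 1]) simp
      thus ?thesis using even[of "x - 1/2"] by simp
    qed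
    have "antimono_on {0..1/2} (\<lambda>x. f (x + 1/2))"
      unfolding refl by (rule monotone_onI, rule monotone_onD[OF 2]) auto
    moreover have "f (- x + 1/2) = f (x + 1/2)" for x
      by (simp add: refl)
    moreover have eq: "f (y + 1/2) = g (y + (1/2 + a))" for y
      by (simp add: f_def add.assoc)
    ultimately show ?thesis unfolding eq by blast
  qed
qed

section \<open>Rearrangement of a translate\<close>

text \<open>Translation invariance is at hand for integrals of continuous functions, so the
  indicator of a superlevel set is approached by continuous functions of g.\<close>

lemma measure_superlevel_shift:
  assumes per: "periodic_fun_simple' g" and cont: "continuous_on UNIV g"
  shows "measure torus {x \<in> space torus. t < g (x + c)} = measure torus {x \<in> space torus. (t::real) < g x}"
proof -
  \<comment> \<open>Ramps of slope n, equal to 0 up to t and, for n > 0, equal to 1 from t + 1/n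
    on.\<close>
  define \<phi> where "\<phi> n r = min 1 (max 0 (real n * (r - t)))" for n :: nat and r :: real
  have \<phi>: "(\<lambda>n. \<phi> n r) \<longlonglongrightarrow> indicator {t<..} r" for r
  proof (cases "t < r")
    case True
    have "eventually (\<lambda>n. real n \<ge> 1 / (r - t)) sequentially"
      using filterlim_real_sequentially by (simp add: filterlim_at_top)
    hence "eventually (\<lambda>n. \<phi> n r = 1) sequentially"
      by eventually_elim (use True in \<open>auto simp: \<phi>_def field_simps\<close>)
    thus ?thesis using True by (simp add: tendsto_eventually)
  next
    case False
    hence "real n * (r - t) \<le> 0" for n by (simp add: mult_nonneg_nonpos)
    hence "\<phi> n r = 0" for n by (simp add: \<phi>_def max_absorb1)
    thus ?thesis using False by simp
  qed
  have lim: "(\<lambda>n. \<integral>x. \<phi> n (h x) \<partial>torus) \<longlonglongrightarrow> measure torus {x \<in> space torus. t < h x}"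
    if h: "continuous_on UNIV h" for h
  proof -
    have [measurable]: "h \<in> borel_measurable torus" by (rule continuous_measurable_torus[OF h])
    have "(\<lambda>n. \<integral>x. \<phi> n (h x) \<partial>torus) \<longlonglongrightarrow> (\<integral>x. indicator {t<..} (h x) \<partial>torus)"
    proof (rule torus_dominated_convergence[where B = 1])
      show "(\<lambda>x. \<phi> n (h x)) \<in> borel_measurable torus" for n
        unfolding \<phi>_def by measurable
      show "\<bar>\<phi> n (h x)\<bar> \<le> 1" for n x by (auto simp: \<phi>_def)
    qed (use \<phi> in measurable)
    also have "(\<integral>x. indicator {t<..} (h x) \<partial>torus) = (\<integral>x. indicator {x \<in> space torus. t < h x} x \<partial>torus)"
      by (intro Bochner_Integration.integral_cong) (auto simp: indicator_def)
    also have "\<dots> = measure torus {x \<in> space torus. t < h x}"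
    proof -
      have "{x \<in> space torus. t < h x} \<inter> space torus = {x \<in> space torus. t < h x}" by blast
      thus ?thesis by (simp only: Bochner_Integration.integral_indicator)
    qed
    finally show ?thesis .
  qed
  have c: "continuous_on UNIV (\<lambda>x. g (x + c))"
    by (intro continuous_on_compose2[OF cont] continuous_intros) simp
  have "(\<integral>x. \<phi> n (g (x + c)) \<partial>torus) = (\<integral>x. \<phi> n (g x) \<partial>torus)" for n
    by (rule torus_integral_shift[of "\<lambda>x. \<phi> n (g x)"])
      (unfold \<phi>_def, unfold_locales, simp add: periodic_fun_simple'.plus_period[OF per], intro continuous_intros cont)
  thus ?thesis
    using LIMSEQ_unique[OF lim[OF c]] lim[OF cont] by simp
qed

text \<open>\<open>sdr\<close> sees only measures of superlevel sets, which null sets and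
  translations do not change. So \<open>sdr \<rho>\<close> is the rearrangement of the centred
  translate of g, which is its own rearrangement.\<close>

lemma sdr_translate:
  assumes ord: "reflection_ordered g" and per: "periodic_fun_simple' g" and cont: "continuous_on UNIV g"
    and nonneg: "\<And>x. 0 \<le> g x" and \<rho>: "\<rho> \<in> borel_measurable torus" "AE x in torus. \<rho> x = g x"
  shows "\<exists>x0\<in>{-1/2<..1/2}. AE x in torus. ennreal (\<rho> x) = sdr \<rho> (x - x0)"
proof -
  obtain c where c: "\<And>x. g (- x + c) = g (x + c)" "antimono_on {0..1/2} (\<lambda>x. g (x + c))"
    using reflection_ordered_centre[OF ord per cont] by blast
  define h where "h x = g (x + c)" for x
  have [measurable]: "g \<in> borel_measurable torus" "\<rho> \<in> borel_measurable torus"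
    using \<rho>(1) continuous_measurable_torus[OF cont] by auto
  have "periodic_fun_simple' h"
    unfolding h_def by unfold_locales (rule periodic_cong_int[OF per, of _ _ 1], simp)
  moreover have "continuous_on UNIV h"
    unfolding h_def by (intro continuous_on_compose2[OF cont] continuous_intros) simp
  ultimately have h: "sdr h x = ennreal (h x)" for x
    by (rule sdr_fixes_continuous) (use c nonneg in \<open>simp_all add: h_def[abs_def]\<close>)
  have "measure torus {x \<in> space torus. t < \<rho> x} = measure torus {x \<in> space torus. t < g x}" for t
  proof (rule torus.finite_measure_eq_AE)
    show "AE x in torus. (x \<in> {x \<in> space torus. t < \<rho> x}) = (x \<in> {x \<in> space torus. t < g x})"
      using \<rho>(2) by eventually_elim simp
  qed measurable
  hence "measure torus {x \<in> space torus. t < \<rho> x} = measure torus {x \<in> space torus. t < h x}" for t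
    unfolding h_def using measure_superlevel_shift[OF per cont] by metis
  hence sdr_eq: "sdr \<rho> = sdr h"
    unfolding sdr_def sdr_set_def by presburger
  define x0 where "x0 = torus_rep c"
  have "g x = h (x - x0)" for x
    unfolding h_def by (rule periodic_cong_int[OF per, of _ _ "- \<lceil>c - 1/2\<rceil>"]) (simp add: x0_def torus_rep_def)
  hence "ennreal (g x) = sdr \<rho> (x - x0)" for x
    unfolding sdr_eq h by simp
  with \<rho>(2) have "AE x in torus. ennreal (\<rho> x) = sdr \<rho> (x - x0)"
    by auto
  thus ?thesis using torus_rep_in[of c] unfolding x0_def by blast
qed

section \<open>Perturbation of the kernel\<close>

lemma cos_kernel: "torus_kernel (\<lambda>x. cos (2 * pi * x))"
proof
  fix x :: real
  show "cos (2 * pi * (x + 1)) = cos (2 * pi * x)" by (simp add: distrib_left)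
qed (auto intro!: continuous_intros)

interpretation cos: torus_kernel "\<lambda>x. cos (2 * pi * x)"
  by (rule cos_kernel)

context torus_kernel
begin

text \<open>The cosine is even, 1-periodic and strictly decreasing on [0, 1/2], so a positive
  \<epsilon> removes the flat parts of W.\<close>

definition perturbed :: "real \<Rightarrow> real \<Rightarrow> real" where
  "perturbed \<epsilon> x = W x + \<epsilon> * cos (2 * pi * x)"

lemma perturbed_kernel: "torus_kernel (perturbed \<epsilon>)"
proof
  show "continuous_on UNIV (perturbed \<epsilon>)"
    unfolding perturbed_def by (intro continuous_intros cont)
  show "perturbed \<epsilon> (x + 1) = perturbed \<epsilon> x" for x
    using periodic_fun_simple'.plus_period[OF per] periodic_fun_simple'.plus_period[OF cos.per]
    by (simp add: perturbed_def)
qed (simp add: perturbed_def even)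

lemma perturbed_strict_antimono:
  assumes anti: "antimono_on {0..1/2} W" and "0 < \<epsilon>"
  shows "strict_antimono_on {0..1/2} (perturbed \<epsilon>)"
proof (rule monotone_onI)
  fix x y :: real assume xy: "x \<in> {0..1/2}" "y \<in> {0..1/2}" "x < y"
  have "W y \<le> W x" by (rule monotone_onD[OF anti]) (use xy in auto)
  moreover have "cos (2 * pi * y) < cos (2 * pi * x)"
    using xy by (intro cos_monotone_0_pi) auto
  ultimately show "perturbed \<epsilon> y < perturbed \<epsilon> x"
    using \<open>0 < \<epsilon>\<close> by (simp add: perturbed_def add_le_less_mono)
qed

lemma conv_perturbed:
  assumes f: "integrable torus f"
  shows "torus_conv (perturbed \<epsilon>) f x = torus_conv W f x + \<epsilon> * torus_conv (\<lambda>x. cos (2 * pi * x)) f x"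
proof -
  have "torus_conv (perturbed \<epsilon>) f x = (\<integral>y. W (x - y) * f y + \<epsilon> * (cos (2 * pi * (x - y)) * f y) \<partial>torus)"
    unfolding torus_conv_def perturbed_def by (simp add: distrib_right mult.assoc)
  thus ?thesis
    using conv_integrable[OF f] cos.conv_integrable[OF f]
    by (simp add: torus_conv_def Bochner_Integration.integral_add)
qed

lemma interaction_perturbed:
  assumes f: "integrable torus f"
  shows "interaction (perturbed \<epsilon>) f f = interaction W f f + \<epsilon> * interaction (\<lambda>x. cos (2 * pi * x)) f f"
proof -
  have "interaction (perturbed \<epsilon>) f f =
      (\<integral>x. f x * torus_conv W f x + \<epsilon> * (f x * torus_conv (\<lambda>x. cos (2 * pi * x)) f x) \<partial>torus)"
    unfolding interaction_def conv_perturbed[OF f] by (simp add: algebra_simps)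
  thus ?thesis
    using interaction_integrable[OF f f] cos.interaction_integrable[OF f f]
    by (simp add: interaction_def Bochner_Integration.integral_add)
qed

end

section \<open>Minimizers for perturbed kernels and their limit\<close>

context free_energy_problem
begin

lemma perturbed_problem: "free_energy_problem (perturbed \<epsilon>) \<beta> M"
  using perturbed_kernel \<beta>_pos M_pos
  by (intro free_energy_problem.intro free_energy_problem_axioms.intro)

text \<open>The fixed point equation is recorded so that convergence of the potentials yields
  pointwise convergence of the minimizers.\<close>

lemma perturbed_minimizer_exists:
  assumes "antimono_on {0..1/2} W" and "0 < \<epsilon>"
  shows "\<exists>g. global_minimizer \<beta> M (perturbed \<epsilon>) g \<and> reflection_ordered g \<and>
    g = gibbs M (\<lambda>x. 2 * \<beta> * torus_conv (perturbed \<epsilon>) g x)"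
proof -
  interpret P: free_energy_problem "perturbed \<epsilon>" \<beta> M
    by (rule perturbed_problem)
  obtain \<rho> where min: "global_minimizer \<beta> M (perturbed \<epsilon>) \<rho>"
    using P.minimizer_exists by blast
  hence \<rho>: "integrable torus \<rho>"
    using admissibleD(2) by (auto simp: P.global_minimizer_iff)
  have "reflection_ordered (P.el_map \<rho>)"
    using perturbed_strict_antimono[OF assms] P.minimizer_el_map(1)[OF min]
      P.el_map_continuous[OF \<rho>] P.el_map_pos[OF \<rho>]
    by (rule P.minimizer_reflection_ordered)
  thus ?thesis
    using P.minimizer_el_map[OF min] by metis
qed

text \<open>The perturbation changes the energy by O(\<epsilon>) uniformly over admissible
  densities, so minimizers for the perturbed kernels form a minimizing sequence for W.\<close>

lemma reflection_ordered_minimizer_exists: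
  assumes anti: "antimono_on {0..1/2} W"
  shows "\<exists>u. periodic_fun_simple' u \<and> continuous_on UNIV u \<and>
    global_minimizer \<beta> M W (gibbs M u) \<and> reflection_ordered (gibbs M u)"
proof -
  define k where "k x = cos (2 * pi * x)" for x :: real
  define \<epsilon> where "\<epsilon> n = 1 / real (Suc n)" for n
  have \<epsilon>: "0 < \<epsilon> n" "\<epsilon> n \<le> 1" for n by (auto simp: \<epsilon>_def)
  have \<epsilon>_lim: "\<epsilon> \<longlonglongrightarrow> 0"
    unfolding \<epsilon>_def using LIMSEQ_inverse_real_of_nat by (simp add: inverse_eq_divide)
  have "\<exists>g. \<forall>n. global_minimizer \<beta> M (perturbed (\<epsilon> n)) (g n) \<and> reflection_ordered (g n) \<and>
      g n = gibbs M (\<lambda>x. 2 * \<beta> * torus_conv (perturbed (\<epsilon> n)) (g n) x)"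
    using perturbed_minimizer_exists[OF anti \<epsilon>(1)] by (intro choice allI)
  then obtain g where g: "\<And>n. global_minimizer \<beta> M (perturbed (\<epsilon> n)) (g n)" "\<And>n. reflection_ordered (g n)"
    "\<And>n. g n = gibbs M (\<lambda>x. 2 * \<beta> * torus_conv (perturbed (\<epsilon> n)) (g n) x)"
    by blast
  have adm: "g n \<in> admissible M" for n
    using g(1)[of n] by (simp add: free_energy_problem.global_minimizer_iff[OF perturbed_problem])
  note int = admissibleD(2)[OF adm]
  define C where "C = cos.bound * M"
  have C: "0 \<le> C" using cos.bound_nonneg M_pos by (simp add: C_def)
  have conv_k: "\<bar>torus_conv k (g n) x\<bar> \<le> C" for n x
    using cos.conv_bound[OF int, of n x] admissibleD(6)[OF adm, of n] by (simp add: C_def k_def[abs_def])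
  have E_k: "\<bar>interaction k f f\<bar> \<le> C * M" if "f \<in> admissible M" for f
    using cos.interaction_bound[OF admissibleD(2)[OF that] admissibleD(2)[OF that]] admissibleD(6)[OF that]
    by (simp add: C_def k_def[abs_def])
  have F: "\<bar>free_energy \<beta> (perturbed (\<epsilon> n)) f - free_energy \<beta> W f\<bar> \<le> \<beta> * (C * M) * \<epsilon> n"
    if f: "f \<in> admissible M" for f n
  proof -
    have "free_energy \<beta> (perturbed (\<epsilon> n)) f - free_energy \<beta> W f = - (\<beta> * \<epsilon> n) * interaction k f f"
      unfolding free_energy_eq interaction_perturbed[OF admissibleD(2)[OF f]] k_def[abs_def]
      by (simp add: algebra_simps)
    also have "\<bar>\<dots>\<bar> \<le> (\<beta> * \<epsilon> n) * (C * M)"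
      using E_k[OF f] \<epsilon>(1)[of n] \<beta>_pos by (simp add: abs_mult)
    finally show ?thesis by (simp add: mult_ac)
  qed
  obtain \<rho> where \<rho>: "\<rho> \<in> admissible M" and lower: "\<And>\<sigma>. \<sigma> \<in> admissible M \<Longrightarrow> free_energy \<beta> W \<rho> \<le> free_energy \<beta> W \<sigma>"
    using minimizer_exists by (auto simp: global_minimizer_iff)
  \<comment> \<open>The factor 2 counts the change of kernel at \<open>g n\<close> and the change
    back at \<open>\<rho>\<close>.\<close>
  have upper: "free_energy \<beta> W (g n) \<le> free_energy \<beta> W \<rho> + 2 * (\<beta> * (C * M) * \<epsilon> n)" for n
  proof -
    have "free_energy \<beta> (perturbed (\<epsilon> n)) (g n) \<le> free_energy \<beta> (perturbed (\<epsilon> n)) \<rho>"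
      using g(1)[of n] \<rho> by (simp add: free_energy_problem.global_minimizer_iff[OF perturbed_problem])
    thus ?thesis using F[OF adm, of n n] F[OF \<rho>, of n] by linarith
  qed
  have lim: "(\<lambda>n. free_energy \<beta> W (g n)) \<longlonglongrightarrow> free_energy \<beta> W \<rho>"
  proof (rule tendsto_sandwich[where f = "\<lambda>_. free_energy \<beta> W \<rho>"
        and h = "\<lambda>n. free_energy \<beta> W \<rho> + 2 * (\<beta> * (C * M) * \<epsilon> n)"])
    have "(\<lambda>n. free_energy \<beta> W \<rho> + 2 * (\<beta> * (C * M) * \<epsilon> n)) \<longlonglongrightarrow> free_energy \<beta> W \<rho> + 2 * (\<beta> * (C * M) * 0)"
      by (intro tendsto_intros \<epsilon>_lim)
    thus "(\<lambda>n. free_energy \<beta> W \<rho> + 2 * (\<beta> * (C * M) * \<epsilon> n)) \<longlonglongrightarrow> free_energy \<beta> W \<rho>" by simp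
  qed (use lower[OF adm] upper in auto)
  obtain r :: "nat \<Rightarrow> nat" and u where r: "strict_mono r"
    and u: "periodic_fun_simple' u" "continuous_on UNIV u"
    and conv: "\<And>x. (\<lambda>n. torus_conv W (g (r n)) x) \<longlonglongrightarrow> u x"
    and min: "global_minimizer \<beta> M W (gibbs M (\<lambda>x. 2 * \<beta> * u x))"
    using minimizing_sequence_limit[of g, OF adm lower lim] by blast
  \<comment> \<open>The potential of g (r n) for the perturbed kernel: its Gibbs density is g (r n)
    itself, and its limit is the potential 2 \<beta> u of the minimizer obtained for W.\<close>
  define v where "v n x = 2 * \<beta> * torus_conv (perturbed (\<epsilon> (r n))) (g (r n)) x" for n x
  have v: "v n x = 2 * \<beta> * (torus_conv W (g (r n)) x + \<epsilon> (r n) * torus_conv k (g (r n)) x)" for n x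
    unfolding v_def conv_perturbed[OF int] k_def[abs_def] ..
  have "(\<lambda>n. gibbs M (v n) x) \<longlonglongrightarrow> gibbs M (\<lambda>x. 2 * \<beta> * u x) x" for x
  proof (rule gibbs_tendsto)
    show "continuous_on UNIV (v n)" for n
      using torus_kernel.conv_continuous[OF perturbed_kernel int]
      unfolding v_def by (intro continuous_intros)
    show "continuous_on UNIV (\<lambda>x. 2 * \<beta> * u x)" by (intro continuous_intros u)
    show "\<bar>v n x\<bar> \<le> 2 * \<beta> * (bound * M + C)" for n x
    proof -
      have "\<bar>\<epsilon> (r n) * torus_conv k (g (r n)) x\<bar> \<le> 1 * C"
        unfolding abs_mult using \<epsilon>[of "r n"] conv_k[of "r n" x] C by (intro mult_mono) auto
      moreover have "\<bar>torus_conv W (g (r n)) x\<bar> \<le> bound * M"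
        using conv_bound[OF int, of "r n" x] admissibleD(6)[OF adm, of "r n"] by simp
      ultimately have "\<bar>torus_conv W (g (r n)) x + \<epsilon> (r n) * torus_conv k (g (r n)) x\<bar> \<le> bound * M + C"
        by linarith
      thus ?thesis unfolding v using \<beta>_pos by (simp add: abs_mult)
    qed
    show "(\<lambda>n. v n x) \<longlonglongrightarrow> 2 * \<beta> * u x" for x
    proof -
      have "(\<lambda>n. \<epsilon> (r n)) \<longlonglongrightarrow> 0"
        using LIMSEQ_subseq_LIMSEQ[OF \<epsilon>_lim r] by (simp add: o_def)
      hence "(\<lambda>n. \<epsilon> (r n) * torus_conv k (g (r n)) x) \<longlonglongrightarrow> 0"
      proof (rule Lim_null_comparison[rotated, OF tendsto_mult_right_zero[of _ _ C]])
        show "eventually (\<lambda>n. norm (\<epsilon> (r n) * torus_conv k (g (r n)) x) \<le> C * \<epsilon> (r n)) sequentially"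
        proof (intro always_eventually allI)
          fix n
          show "norm (\<epsilon> (r n) * torus_conv k (g (r n)) x) \<le> C * \<epsilon> (r n)"
            using \<epsilon>(1)[of "r n"] conv_k[of "r n" x] by (simp add: abs_mult mult.commute)
        qed
      qed
      hence "(\<lambda>n. v n x) \<longlonglongrightarrow> 2 * \<beta> * (u x + 0)"
        unfolding v by (intro tendsto_intros conv)
      thus ?thesis by simp
    qed
  qed
  moreover have "gibbs M (v n) = g (r n)" for n
    using g(3)[of "r n"] by (simp add: v_def[abs_def])
  ultimately have g_lim: "(\<lambda>n. g (r n) x) \<longlonglongrightarrow> gibbs M (\<lambda>x. 2 * \<beta> * u x) x" for x
    by simp
  have "reflection_ordered (gibbs M (\<lambda>x. 2 * \<beta> * u x))"
    by (rule reflection_ordered_limit[of "\<lambda>n. g (r n)", OF g(2) g_lim])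
  moreover have "periodic_fun_simple' (\<lambda>x. 2 * \<beta> * u x)" "continuous_on UNIV (\<lambda>x. 2 * \<beta> * u x)"
    using u by (auto simp: periodic_fun_simple'_def intro!: continuous_intros)
  ultimately show ?thesis using min by blast
qed

end

section \<open>From reflection order to the rearranged form of minimizers\<close>

theorem proposition7:
  fixes \<beta> M :: real and W :: "real \<Rightarrow> real"
  assumes "\<beta> > 0" and "M > 0"
    and "periodic_fun_simple' W" and "continuous_on UNIV W"
    and "\<forall>x. 0 \<le> W x" and "(\<integral>x. W x \<partial>torus) = 1"
    and "\<forall>x. ennreal (W x) = sdr W x"
  shows "(\<exists>\<rho>. global_minimizer \<beta> M W \<rho> \<and>
            (\<exists>x0\<in>{-1/2<..1/2}. AE x in torus. ennreal (\<rho> x) = sdr \<rho> (x - x0))) \<and>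
         (strict_antimono_on {0..1/2} W \<longrightarrow>
            (\<forall>\<rho>. global_minimizer \<beta> M W \<rho> \<longrightarrow>
              (\<exists>x0\<in>{-1/2<..1/2}. AE x in torus. ennreal (\<rho> x) = sdr \<rho> (x - x0))))"
proof -
  have W: "0 \<le> W x" "ennreal (W x) = sdr W x" for x
    using assms(5,7) by auto
  \<comment> \<open>Evenness, and below monotonicity, transfer from the rearrangement because
    \<open>ennreal\<close> is injective and reflects the order on nonnegative reals.\<close>
  have even: "W (- x) = W x" for x
    using sdr_even[of W x] W(1)[of x] W(1)[of "- x"] by (simp flip: W(2))
  have anti: "antimono_on {0..1/2} W"
  proof (rule monotone_onI)
    fix x y :: real assume "x \<in> {0..1/2}" "y \<in> {0..1/2}" "x \<le> y"
    from monotone_onD[OF sdr_antimono[of W] this] show "W y \<le> W x"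
      using W(1)[of x] W(1)[of y] by (simp flip: W(2))
  qed
  interpret free_energy_problem W \<beta> M
    by (intro free_energy_problem.intro torus_kernel.intro free_energy_problem_axioms.intro assms even)
  have "\<exists>\<rho>. global_minimizer \<beta> M W \<rho> \<and>
      (\<exists>x0\<in>{-1/2<..1/2}. AE x in torus. ennreal (\<rho> x) = sdr \<rho> (x - x0))"
  proof -
    obtain u where u: "periodic_fun_simple' u" "continuous_on UNIV u"
      and min: "global_minimizer \<beta> M W (gibbs M u)" and ord: "reflection_ordered (gibbs M u)"
      using reflection_ordered_minimizer_exists[OF anti] by blast
    note cont = gibbs_continuous[OF u M_pos]
    have "\<exists>x0\<in>{-1/2<..1/2}. AE x in torus. ennreal (gibbs M u x) = sdr (gibbs M u) (x - x0)"
      by (rule sdr_translate[OF ord gibbs_periodic[OF u M_pos] cont _ continuous_measurable_torus[OF cont]])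
        (use gibbs_pos[OF u M_pos] in \<open>simp_all add: less_imp_le\<close>)
    thus ?thesis using min by blast
  qed
  moreover have "\<exists>x0\<in>{-1/2<..1/2}. AE x in torus. ennreal (\<rho> x) = sdr \<rho> (x - x0)"
    if strict: "strict_antimono_on {0..1/2} W" and min: "global_minimizer \<beta> M W \<rho>" for \<rho>
  proof -
    have int: "integrable torus \<rho>"
      using min admissibleD(2) by (auto simp: global_minimizer_iff)
    note pos = el_map_pos[OF int] and cont = el_map_continuous[OF int]
    \<comment> \<open>Ordering is proved for the continuous representative;
      \<open>sdr_translate\<close> carries the conclusion over to \<open>\<rho>\<close>, which
      agrees with it almost everywhere.\<close>
    have "reflection_ordered (el_map \<rho>)"
      by (rule minimizer_reflection_ordered[OF strict minimizer_el_map(1)[OF min] cont pos])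
    thus ?thesis
      by (rule sdr_translate[OF _ el_map_periodic[OF int] cont _ _ minimizer_euler_lagrange[OF min]])
        (use pos int in \<open>simp_all add: less_imp_le\<close>)
  qed
  ultimately show ?thesis by blast
qed

end
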